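(* Let $p>0$ and let $m\ge 1$ be an integer. Then $$\zeta_p(-m)=-\frac{1}{m+1}B_{m+1}^{(2,p)}.$$ Consequently, $$\eta_p(2m)=\frac{(-1)^{m+1}(2\pi)^{2m}}{2\,(2m)!}\,B_{2m}^{(2,p)}.$$
   Context: Fix a real number $p>0$. Let $0<\lambda_1<\lambda_2<\cdots$ be the positive roots of the equation $p\sin(\pi\lambda)+\lambda\cos(\pi\lambda)=0$. The first Koshliakov zeta function is $$\zeta_p(s):=\sum_{j=1}^\infty\frac{p^2+\lambda_j^2}{p\left(p+\frac1\pi\right)+\lambda_j^2}\frac1{\lambda_j^s}\qquad(\mathrm{Re}(s)>1).$$ For $\nu>0$, $k$ a positive integer and $\mathrm{Re}(s)>0$ put $$(s,\nu k)_k:=\frac1{\Gamma(s)}\int_0^\infty e^{-x}\left(\frac{k\nu-x}{k\nu+x}\right)^kx^{s-1}\,dx .$$ The second Koshliakov zeta function is $$\eta_p(s):=\sum_{k=1}^\infty\frac{(s,2\pi pk)_k}{k^s}\qquad(\mathrm{Re}(s)>1).$$ Both $\zeta_p$ and $\eta_p$ extend meromorphically to $\mathbb{C}$ with a single simple pole, at $s=1$; the same symbols denote the continuations. They are related by Koshliakov's functional equation $\zeta_p(1-s)=2^{1-s}\pi^{-s}\cos\left(\frac{\pi s}{2}\right)\Gamma(s)\eta_p(s)$. The generalized Bernoulli numbers of the second kind $B_n^{(2,p)}$ ($n\ge0$) are defined by the generating function $$\sum_{n=0}^\infty\frac{B_n^{(2,p)}}{n!}t^n=t\,\sigma_p(t)\quad(0<t<1),\qquad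 \sigma_p(t):=\sum_{j=1}^\infty\frac{p^2+\lambda_j^2}{p\left(p+\frac1\pi\right)+\lambda_j^2}e^{-\lambda_jt}\quad(\mathrm{Re}(t)>0).$$ *)

theory Defs
  imports "HOL-Complex_Analysis.Complex_Analysis"
begin

definition koshliakov_roots :: "real \<Rightarrow> real set" where
  "koshliakov_roots p = {x. 0 < x \<and> p * sin (pi * x) + x * cos (pi * x) = 0}"

text \<open>The increasing enumeration of the positive roots. Indices start at \<open>0\<close>, so
  \<open>koshliakov_root p j\<close> is \<open>\<lambda>\<^sub>j\<^sub>+\<^sub>1\<close>.\<close>
definition koshliakov_root :: "real \<Rightarrow> nat \<Rightarrow> real" where
  "koshliakov_root p = (THE r. strict_mono r \<and> range r = koshliakov_roots p)"

definition koshliakov_weight :: "real \<Rightarrow> nat \<Rightarrow> real" where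
  "koshliakov_weight p j =
     (p\<^sup>2 + (koshliakov_root p j)\<^sup>2) / (p * (p + 1 / pi) + (koshliakov_root p j)\<^sup>2)"

text \<open>The meromorphic continuation of \<open>f\<close> from \<open>A\<close> to the whole plane. Being nicely meromorphic
  fixes the value at every removable singularity (the limit) and at every pole (\<open>0\<close>), so that
  the continuation is unique as a function when \<open>A\<close> is a half-plane.\<close>
definition meromorphic_continuation :: "complex set \<Rightarrow> (complex \<Rightarrow> complex) \<Rightarrow> complex \<Rightarrow> complex" where
  "meromorphic_continuation A f =
     (THE g. g nicely_meromorphic_on UNIV \<and> (\<forall>s\<in>A. g s = f s))"

definition koshliakov_zeta_series :: "real \<Rightarrow> complex \<Rightarrow> complex" where
  "koshliakov_zeta_series p s =
     (\<Sum>j. of_real (koshliakov_weight p j) * (1 / of_real (koshliakov_root p j) powr s))"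

definition koshliakov_zeta :: "real \<Rightarrow> complex \<Rightarrow> complex" where
  "koshliakov_zeta p = meromorphic_continuation {s. Re s > 1} (koshliakov_zeta_series p)"

text \<open>\<open>koshliakov_symbol s \<nu> k\<close> is \<open>(s, \<nu>k)\<^sub>k\<close>; the second argument is \<open>\<nu>\<close>, not \<open>\<nu>k\<close>.\<close>
definition koshliakov_symbol :: "complex \<Rightarrow> real \<Rightarrow> nat \<Rightarrow> complex" where
  "koshliakov_symbol s \<nu> k =
     1 / Gamma s * (LBINT x:{0<..}.
       of_real (exp (- x) * ((real k * \<nu> - x) / (real k * \<nu> + x)) ^ k) * of_real x powr (s - 1))"

definition koshliakov_eta_series :: "real \<Rightarrow> complex \<Rightarrow> complex" where
  "koshliakov_eta_series p s =
     (\<Sum>k. koshliakov_symbol s (2 * pi * p) (Suc k) / of_nat (Suc k) powr s)"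

definition koshliakov_eta :: "real \<Rightarrow> complex \<Rightarrow> complex" where
  "koshliakov_eta p = meromorphic_continuation {s. Re s > 1} (koshliakov_eta_series p)"

definition koshliakov_sigma :: "real \<Rightarrow> complex \<Rightarrow> complex" where
  "koshliakov_sigma p t =
     (\<Sum>j. of_real (koshliakov_weight p j) * exp (- (of_real (koshliakov_root p j) * t)))"

definition gen_bernoulli2 :: "real \<Rightarrow> nat \<Rightarrow> real" where
  "gen_bernoulli2 p = (THE B. \<forall>t::real. 0 < t \<and> t < 1 \<longrightarrow>
     (\<lambda>n. complex_of_real (B n) / fact n * of_real t ^ n) sums
       (of_real t * koshliakov_sigma p (of_real t)))"

end

theory Submission
  imports Defs
begin

text \<open>
  Put \<open>f z = p sin (\<pi> z) + z cos (\<pi> z)\<close> and \<open>g z = p cos (\<pi> z) - z sin (\<pi> z)\<close>. The zeros of \<open>f\<close>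
  are real, and at a positive zero \<open>\<lambda>\<^sub>j\<close> the residue of \<open>\<pi> g / f\<close> is exactly the weight
  \<open>(p\<^sup>2 + \<lambda>\<^sub>j\<^sup>2) / (p (p + 1/\<pi>) + \<lambda>\<^sub>j\<^sup>2)\<close>. So \<open>\<sigma>\<^sub>p(t)\<close> is a sum of residues of \<open>\<pi> (g / f) e\<^bsup>-zt\<^esup>\<close>.
  In the upper half-plane \<open>g / f = -\<i> (1 + 2 q / (1 - q))\<close>, where
  \<open>q = (p + \<i>z) / (p - \<i>z) \<cdot> e\<^bsup>2\<pi>\<i>z\<^esup>\<close> decays exponentially, and the lower half-plane is its mirror
  image. Moving the contour to the imaginary axis, where \<open>q\<close> becomes
  \<open>(p - y) / (p + y) \<cdot> e\<^bsup>-2\<pi>y\<^esup>\<close> (the definition \<open>koshliakov_ratio\<close>) and \<open>q / (1 - q)\<close> becomes a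
  real function \<open>h\<close> (\<open>koshliakov_kernel\<close>), one finds, with a constant \<open>C\<close>,
  \<open>\<sigma>\<^sub>p(t) = 1/t + C + 2 \<integral> h(y) sin(ty) dy\<close>, the integral being over \<open>y > 0\<close>. This is lemma
  \<open>koshliakov_sigma_formula\<close>, stated for \<open>\<sigma>\<^sub>p(t) - \<sigma>\<^sub>p(1)\<close>.

  Expanding the sine under the integral (\<open>gen_bernoulli2_sums\<close>) shows that \<open>B\<^sub>n\<close> vanishes for odd
  \<open>n \<ge> 3\<close> and that, for even \<open>n \<ge> 2\<close>, \<open>B\<^sub>n\<close> is \<open>2n (-1)\<^bsup>n/2-1\<^esup>\<close> times the moment \<open>\<integral> h(y) y\<^bsup>n-1\<^esup> dy\<close>.

  Both zeta functions are normalised Mellin transforms: termwise integration gives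
  \<open>\<Gamma>(s) \<zeta>\<^sub>p(s) = \<integral> \<sigma>\<^sub>p(t) t\<^bsup>s-1\<^esup> dt\<close>, and, since the \<open>k\<close>-th summand of \<open>\<eta>\<^sub>p\<close> is a rescaled Mellin
  transform of \<open>q\<^sup>k\<close> and \<open>h\<close> is the sum of the powers of \<open>q\<close>,
  \<open>\<Gamma>(s) \<eta>\<^sub>p(s) = (2\<pi>)\<^sup>s \<integral> h(y) y\<^bsup>s-1\<^esup> dy\<close>. Each of \<open>\<sigma>\<^sub>p\<close> and \<open>h\<close> decays exponentially and has
  near \<open>0\<close> the form of a power series divided by the variable. For such a function
  \<open>Mellin_continuation\<close> continues the normalised Mellin transform to the plane with at most a
  simple pole at \<open>1\<close>, and evaluates it at \<open>-m\<close> as \<open>(-1)\<^sup>m m!\<close> times a coefficient of the power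
  series. For \<open>\<sigma>\<^sub>p\<close> that gives \<open>\<zeta>\<^sub>p(-m) = (-1)\<^sup>m B\<^sub>m\<^sub>+\<^sub>1 / (m+1)\<close>, and the vanishing of the odd
  \<open>B\<^sub>n\<close> turns the sign into \<open>-1\<close>. The point \<open>2m\<close> lies where the series for \<open>\<eta>\<^sub>p\<close> converges, so
  \<open>\<eta>\<^sub>p(2m)\<close> is \<open>(2\<pi>)\<^bsup>2m\<^esup> / (2m-1)!\<close> times the moment that also appears in \<open>B\<^sub>2\<^sub>m\<close>.
\<close>

section \<open>The roots and the weights\<close>

lemma strict_mono_range_unique:
  fixes r r' :: "nat \<Rightarrow> 'a::linorder"
  assumes "strict_mono r" "strict_mono r'" "range r = range r'"
  shows "r = r'"
proof -
  have le: "u n \<le> v n"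
    if uv: "strict_mono u" "strict_mono v" "range u = range v" "\<And>k. k < n \<Longrightarrow> u k = v k"
    for u v :: "nat \<Rightarrow> 'a" and n
  proof -
    obtain i where i: "v n = u i"
      using uv(3) by (metis imageE rangeI)
    have "n \<le> i"
      using uv(4)[of i] uv(2) i by (metis less_irrefl not_le_imp_less strict_mono_less)
    then show ?thesis
      using i uv(1) by (simp add: strict_mono_less_eq)
  qed
  have "r n = r' n" for n
  proof (induction n rule: less_induct)
    case (less n)
    then show ?case
      using le[of r r' n] le[of r' r n] assms by force
  qed
  then show ?thesis by blast
qed

text \<open>
  On \<open>(j + 1/2, j + 1)\<close> the equation says \<open>tan (\<pi> x) = - x / p\<close>. The left side increases and the
  right side decreases, so there is at most one solution; the left side of the original equation has
  opposite signs at the two end points, so there is one.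
\<close>
lemma koshliakov_equation_unique_solution:
  fixes p :: real
  assumes "p > 0"
  shows "\<exists>!x. x \<in> {real j + 1/2<..<real j + 1} \<and> p * sin (pi * x) + x * cos (pi * x) = 0"
proof -
  define F where "F = (\<lambda>x. p * sin (pi * x) + x * cos (pi * x))"
  have sin_half: "sin (pi * (real j + 1/2)) = (-1) ^ j" "cos (pi * (real j + 1/2)) = 0"
    by (simp_all add: distrib_left sin_add cos_add mult.commute[of pi])
  have F_left: "F (real j + 1/2) = p * (-1) ^ j"
    unfolding F_def sin_half by simp
  have "sin (pi * (real j + 1)) = 0" "cos (pi * (real j + 1)) = (-1) ^ (j + 1)"
    by (simp_all add: distrib_left sin_add cos_add mult.commute[of pi])
  hence F_right: "F (real j + 1) = (real j + 1) * (-1) ^ (j + 1)"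
    unfolding F_def by simp
  have cont: "continuous_on {real j + 1/2..real j + 1} F"
    unfolding F_def by (intro continuous_intros)
  have "\<exists>x\<ge>real j + 1/2. x \<le> real j + 1 \<and> F x = 0"
  proof (cases "even j")
    case True
    then show ?thesis
      using F_left F_right assms cont
      by (intro IVT2') auto
  next
    case False
    then show ?thesis
      using F_left F_right assms cont
      by (intro IVT') auto
  qed
  then obtain x where x: "real j + 1/2 \<le> x" "x \<le> real j + 1" "F x = 0" by blast
  have "x \<noteq> real j + 1/2" "x \<noteq> real j + 1"
    using x F_left F_right assms by auto
  hence x': "x \<in> {real j + 1/2<..<real j + 1}"
    using x by auto
  have tan_root: "tan (pi * (x - (real j + 1))) = - x / p"
      and arg: "-pi/2 < pi * (x - (real j + 1))" "pi * (x - (real j + 1)) < pi/2"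
    if x: "x \<in> {real j + 1/2<..<real j + 1}" and Fx: "F x = 0" for x
  proof -
    have "pi * (- 1/2) < pi * (x - (real j + 1))"
      using x by (intro mult_strict_left_mono) auto
    then show a1: "-pi/2 < pi * (x - (real j + 1))" by simp
    have "pi * (x - (real j + 1)) < pi * (1/2)"
      using x by (intro mult_strict_left_mono) auto
    then show a2: "pi * (x - (real j + 1)) < pi/2" by simp
    have c: "cos (pi * (x - (real j + 1))) > 0"
      using a1 a2 by (intro cos_gt_zero_pi) auto
    define y where "y = pi * (x - (real j + 1))"
    have px: "pi * x = (y + real j * pi) + pi"
      by (simp add: y_def algebra_simps)
    have "F x = - ((-1) ^ j * (p * sin y + x * cos y))"
      unfolding F_def px by (simp add: sin_add cos_add algebra_simps)
    hence "p * sin (pi * (x - (real j + 1))) + x * cos (pi * (x - (real j + 1))) = 0"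
      using Fx by (simp add: y_def)
    hence "p * sin (pi * (x - (real j + 1))) = - x * cos (pi * (x - (real j + 1)))"
      by linarith
    then show "tan (pi * (x - (real j + 1))) = - x / p"
      using c assms by (simp add: tan_def field_simps)
  qed
  have less: False
    if "x \<in> {real j + 1/2<..<real j + 1}" "F x = 0"
       "y \<in> {real j + 1/2<..<real j + 1}" "F y = 0" "x < y" for x y
  proof -
    have "tan (pi * (x - (real j + 1))) < tan (pi * (y - (real j + 1)))"
      using arg[of x] arg[of y] that by (intro tan_monotone) auto
    moreover have "- y / p < - x / p"
      using \<open>x < y\<close> assms by (simp add: divide_strict_right_mono)
    ultimately show False
      using tan_root[of x] tan_root[of y] that by simp
  qed
  show ?thesis
  proof (rule ex1I[of _ x])
    show "x \<in> {real j + 1/2<..<real j + 1} \<and> p * sin (pi * x) + x * cos (pi * x) = 0"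
      using x' x(3) by (simp add: F_def)
    fix y
    assume "y \<in> {real j + 1/2<..<real j + 1} \<and> p * sin (pi * y) + y * cos (pi * y) = 0"
    then have "y \<in> {real j + 1/2<..<real j + 1}" "F y = 0"
      by (simp_all add: F_def)
    then show "y = x"
      using less[of x y] less[of y x] x' x(3) by (meson linorder_cases)
  qed
qed

text \<open>
  If the fractional part of \<open>x > 0\<close> is at most \<open>1/2\<close>, then \<open>sin (\<pi> x)\<close> and \<open>cos (\<pi> x)\<close> do not have
  opposite signs and are not both \<open>0\<close>, which rules out a solution.
\<close>
lemma koshliakov_roots_in_half_interval:
  fixes p :: real
  assumes "p > 0" "x \<in> koshliakov_roots p"
  obtains j :: nat where "x \<in> {real j + 1/2<..<real j + 1}"
proof -
  define j where "j = nat \<lfloor>x\<rfloor>"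
  have x: "x > 0" "p * sin (pi * x) + x * cos (pi * x) = 0"
    using assms by (auto simp: koshliakov_roots_def)
  have j: "real j \<le> x" "x < real j + 1"
    using x(1) unfolding j_def by linarith+
  define y where "y = x - real j"
  have px: "pi * x = pi * y + real j * pi"
    by (simp add: y_def algebra_simps)
  have "(-1) ^ j * (p * sin (pi * y) + x * cos (pi * y)) = 0"
    using x(2) unfolding px by (simp add: sin_add cos_add algebra_simps)
  hence eq: "p * sin (pi * y) + x * cos (pi * y) = 0"
    by simp
  have "\<not> y \<le> 1/2"
  proof
    assume "y \<le> 1/2"
    then have b: "0 \<le> pi * y" "pi * y \<le> pi / 2"
      using j \<open>y \<le> 1/2\<close> by (auto simp: y_def)
    then have "- (pi / 2) \<le> pi * y"
      using pi_gt_zero by linarith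
    then have "sin (pi * y) \<ge> 0" "cos (pi * y) \<ge> 0"
      using b pi_gt_zero by (intro sin_ge_zero cos_ge_zero; linarith)+
    then have "p * sin (pi * y) = 0" "x * cos (pi * y) = 0"
      using eq assms(1) x(1)
      by (smt (verit) mult_nonneg_nonneg)+
    then show False
      using assms(1) x(1) sin_cos_squared_add[of "pi * y"] by simp
  qed
  then show ?thesis
    using that[of j] j by (auto simp: y_def)
qed

text \<open>
  The roots lie one in each interval \<open>(j + 1/2, j + 1)\<close>, so choosing them in order is the unique
  increasing enumeration, and the definite description in the definition of \<^const>\<open>koshliakov_root\<close>
  is not vacuous.
\<close>
lemma koshliakov_root_enumeration:
  fixes p :: real
  assumes "p > 0"
  shows "strict_mono (koshliakov_root p)"
    and "range (koshliakov_root p) = koshliakov_roots p"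
    and "koshliakov_root p j \<in> {real j + 1/2<..<real j + 1}"
proof -
  define r where
    "r = (\<lambda>j::nat. THE x. x \<in> {real j + 1/2<..<real j + 1} \<and> p * sin (pi * x) + x * cos (pi * x) = 0)"
  have r: "r j \<in> {real j + 1/2<..<real j + 1}" "p * sin (pi * r j) + r j * cos (pi * r j) = 0" for j
    using theI'[OF koshliakov_equation_unique_solution[OF assms, of j]] unfolding r_def by blast+
  have mono: "strict_mono r"
  proof (rule strict_mono_Suc_iff[THEN iffD2], rule allI)
    fix n
    show "r n < r (Suc n)" using r(1)[of n] r(1)[of "Suc n"] by auto
  qed
  have ran: "range r = koshliakov_roots p"
  proof
    show "range r \<subseteq> koshliakov_roots p"
    proof
      fix x assume "x \<in> range r"
      then obtain j where x: "x = r j" by blast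
      show "x \<in> koshliakov_roots p"
        using r[of j] unfolding x koshliakov_roots_def by auto
    qed
    show "koshliakov_roots p \<subseteq> range r"
    proof
      fix x assume x: "x \<in> koshliakov_roots p"
      then obtain j :: nat where "x \<in> {real j + 1/2<..<real j + 1}"
        using koshliakov_roots_in_half_interval assms by blast
      moreover have "p * sin (pi * x) + x * cos (pi * x) = 0"
        using x by (simp add: koshliakov_roots_def)
      ultimately have "x = r j"
        using koshliakov_equation_unique_solution[OF assms, of j] r[of j] by blast
      then show "x \<in> range r" by blast
    qed
  qed
  have "koshliakov_root p = r"
    unfolding koshliakov_root_def
  proof (rule the_equality)
    show "strict_mono r \<and> range r = koshliakov_roots p"
      using mono ran by blast
    show "r' = r" if "strict_mono r' \<and> range r' = koshliakov_roots p" for r'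
      using strict_mono_range_unique[of r' r] that mono ran by simp
  qed
  with mono ran r show "strict_mono (koshliakov_root p)"
      "range (koshliakov_root p) = koshliakov_roots p"
      "koshliakov_root p j \<in> {real j + 1/2<..<real j + 1}"
    by auto
qed

lemma koshliakov_weight_bounds:
  assumes "p > 0"
  shows "0 < koshliakov_weight p j" "koshliakov_weight p j \<le> 1"
proof -
  have "p * (p + 1 / pi) = p\<^sup>2 + p / pi"
    by (simp add: power2_eq_square algebra_simps)
  moreover have "p / pi > 0" using assms by simp
  moreover have "p\<^sup>2 > 0" using assms by simp
  moreover have "(koshliakov_root p j)\<^sup>2 \<ge> 0" by simp
  ultimately have "0 < p\<^sup>2 + (koshliakov_root p j)\<^sup>2"
    "p\<^sup>2 + (koshliakov_root p j)\<^sup>2 \<le> p * (p + 1 / pi) + (koshliakov_root p j)\<^sup>2"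
    by linarith+
  then show "0 < koshliakov_weight p j" "koshliakov_weight p j \<le> 1"
    unfolding koshliakov_weight_def by (auto intro!: divide_pos_pos)
qed

section \<open>Uniqueness of the continuation and of the coefficients\<close>

text \<open>
  Two nicely meromorphic functions that agree on the half-plane differ by a meromorphic function that
  vanishes there, hence almost everywhere; being nicely meromorphic then forces equality at the
  remaining points too. The point \<open>1\<close> is excluded because the value there depends on whether
  \<open>E 1 = 0\<close>.
\<close>
lemma meromorphic_continuation_eqI:
  assumes E: "E holomorphic_on UNIV"
      and f: "\<And>s. Re s > 1 \<Longrightarrow> f s = E s / (s - 1)"
      and s: "s \<noteq> 1"
  shows "meromorphic_continuation {s. Re s > 1} f s = E s / (s - 1)"
proof -
  define A where "A = {s::complex. Re s > 1}"
  \<comment> \<open>The quotient itself need not be nicely meromorphic: it has the value \<open>0\<close> at \<open>1\<close> even if the singularity is removable.\<close>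
  define g where "g = remove_sings (\<lambda>s. E s / (s - 1))"
  have mero: "(\<lambda>s. E s / (s - 1)) meromorphic_on UNIV"
    using E by (intro meromorphic_intros analytic_on_imp_meromorphic_on)
      (auto simp: analytic_on_open)
  have nice: "g nicely_meromorphic_on UNIV"
    unfolding g_def using mero by (rule remove_sings_nicely_meromorphic)
  have g_eq: "g s = E s / (s - 1)" if "s \<noteq> 1" for s
  proof -
    have "(\<lambda>s. E s / (s - 1)) holomorphic_on (- {1})"
      using E by (intro holomorphic_intros) (auto intro: holomorphic_on_subset)
    then have "(\<lambda>s. E s / (s - 1)) analytic_on {s}"
      using that by (intro holomorphic_on_imp_analytic_at[of _ "-{1}"]) auto
    then show ?thesis
      unfolding g_def by simp
  qed
  have gA: "\<forall>s\<in>A. g s = f s"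
  proof
    fix s assume "s \<in> A"
    then have "Re s > 1" by (simp add: A_def)
    then show "g s = f s" using g_eq[of s] f[of s] by force
  qed
  have uniq: "h = g" if h: "h nicely_meromorphic_on UNIV" "\<forall>s\<in>A. h s = f s" for h
  proof -
    define d where "d = remove_sings (\<lambda>s. h s - g s)"
    have hm: "h meromorphic_on UNIV" and gm: "g meromorphic_on UNIV"
      using h nice by (auto simp: nicely_meromorphic_on_def)
    have dm: "(\<lambda>s. h s - g s) meromorphic_on UNIV"
      using hm gm by (intro meromorphic_intros)
    have dn: "d nicely_meromorphic_on UNIV"
      unfolding d_def using dm by (rule remove_sings_nicely_meromorphic)
    have opA: "open A"
      unfolding A_def using open_halfspace_Re_gt .
    have d0: "d s = 0" if "s \<in> A" for s
    proof -
      have "eventually (\<lambda>s. h s - g s = 0) (at s)"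
        using opA that h(2) gA by (auto simp: eventually_at_topological)
      then show ?thesis
        unfolding d_def by (intro remove_sings_eqI tendsto_eventually)
    qed
    have two: "2 \<in> A" by (simp add: A_def)
    have "frequently (\<lambda>s. d s = 0) (at 2)"
    proof (rule eventually_frequently)
      show "eventually (\<lambda>s. d s = 0) (at 2)"
        using opA two d0 by (auto simp: eventually_at_topological)
    qed auto
    then have d_zero: "d s = 0" for s
      using frequently_eq_meromorphic_imp_constant[OF _ dn, of 0 2 s] by auto
    have ev: "eventually (\<lambda>s. h s = g s) (at s)" for s
    proof -
      have "eventually (\<lambda>s. remove_sings (\<lambda>s. h s - g s) s = h s - g s) (cosparse UNIV)"
        using dm by (rule eventually_remove_sings_eq)
      then have "eventually (\<lambda>s. h s = g s) (cosparse UNIV)"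
        by eventually_elim (use d_zero in \<open>simp add: d_def\<close>)
      then show ?thesis
        by (simp add: eventually_cosparse_open_eq)
    qed
    show ?thesis
    proof
      fix s
      have "is_pole h s \<longleftrightarrow> is_pole g s"
        by (rule is_pole_cong[OF ev refl])
      moreover have "(is_pole h s \<and> h s = 0) \<or> h \<midarrow>s\<rightarrow> h s" "(is_pole g s \<and> g s = 0) \<or> g \<midarrow>s\<rightarrow> g s"
        using h(1) nice by (auto simp: nicely_meromorphic_on_def)
      moreover have "\<not> is_pole h s" if "h \<midarrow>s\<rightarrow> h s"
        using that not_tendsto_and_filterlim_at_infinity[of "at s" h] by (auto simp: is_pole_def)
      moreover have "\<not> is_pole g s" if "g \<midarrow>s\<rightarrow> g s"
        using that not_tendsto_and_filterlim_at_infinity[of "at s" g] by (auto simp: is_pole_def)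
      moreover have "h s = g s" if "h \<midarrow>s\<rightarrow> h s" "g \<midarrow>s\<rightarrow> g s"
        using that tendsto_cong[OF ev[of s], of "h s"] LIM_unique by blast
      ultimately show "h s = g s" by metis
    qed
  qed
  have "meromorphic_continuation A f = g"
    unfolding meromorphic_continuation_def
  proof (rule the_equality)
    show "g nicely_meromorphic_on UNIV \<and> (\<forall>s\<in>A. g s = f s)"
      using nice gA by blast
    show "h = g" if "h nicely_meromorphic_on UNIV \<and> (\<forall>s\<in>A. h s = f s)" for h
      using uniq that by blast
  qed
  then show ?thesis
    using g_eq[OF s] by (simp add: A_def)
qed

text \<open>
  Only positive real arguments are given. A power series whose constant term is \<open>0\<close> and which is not
  identically \<open>0\<close> has no zeros close to \<open>0\<close> other than \<open>0\<close>, so the coefficients of the difference vanish.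
\<close>
lemma powser_unique_on_unit_interval:
  fixes a b :: "nat \<Rightarrow> real"
  assumes a: "\<And>t. 0 < t \<Longrightarrow> t < 1 \<Longrightarrow> (\<lambda>n. a n * t ^ n) sums F t"
      and b: "\<And>t. 0 < t \<Longrightarrow> t < 1 \<Longrightarrow> (\<lambda>n. b n * t ^ n) sums F t"
  shows "a = b"
proof (rule ccontr)
  assume "a \<noteq> b"
  then obtain m where m: "a m \<noteq> b m" by blast
  define d where "d = (\<lambda>n. a n - b n)"
  have d_sums: "(\<lambda>n. d n * t ^ n) sums 0" if "0 < t" "t < 1" for t
    using sums_diff[OF a[OF that] b[OF that]] by (simp add: d_def algebra_simps)
  have summ: "summable (\<lambda>n. d n * x ^ n)" if "\<bar>x\<bar> < 1" for x
  proof -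
    define t where "t = (1 + \<bar>x\<bar>) / 2"
    have "0 < t" "t < 1" "\<bar>x\<bar> < t" using that by (auto simp: t_def)
    then show ?thesis
      using powser_inside[of d t x] d_sums[of t] by (auto simp: sums_iff)
  qed
  define f where "f = (\<lambda>x. \<Sum>n. d n * x ^ n)"
  have f0: "f t = 0" if "0 < t" "t < 1" for t
    using d_sums[OF that] by (simp add: f_def sums_iff)
  have fs: "(\<lambda>n. d n * x ^ n) sums f x" if "\<bar>x\<bar> < 1" for x
    using summ[OF that] by (simp add: f_def summable_sums)
  have lim: "(f \<longlongrightarrow> d 0) (at 0)"
    by (rule powser_limit_0[of 1 d f]) (use fs in auto)
  have "(f \<longlongrightarrow> 0) (at_right 0)"
  proof (rule tendsto_eventually)
    show "eventually (\<lambda>t. f t = 0) (at_right 0)"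
      using eventually_at_right_real[of 0 1] f0 by (auto elim: eventually_mono)
  qed
  moreover have "(f \<longlongrightarrow> d 0) (at_right 0)"
    using lim by (rule tendsto_mono[OF at_le, rotated]) auto
  ultimately have d0: "d 0 = 0"
    using tendsto_unique trivial_limit_at_right_real by blast
  then have "f 0 = 0" by (simp add: f_def)
  moreover have "d m \<noteq> 0" "m > 0" using m d0 by (auto simp: d_def intro: gr0I)
  ultimately obtain s where s: "0 < s" "\<And>z. z \<in> cball 0 s - {0} \<Longrightarrow> f z \<noteq> 0"
    using powser_0_nonzero[of 1 0 d f m] fs by auto
  then have "f (min s (1/2)) \<noteq> 0"
    by (intro s(2)) auto
  then show False using f0[of "min s (1/2)"] s(1) by auto
qed

lemma gen_bernoulli2_eqI:
  assumes "\<And>t. 0 < t \<Longrightarrow> t < 1 \<Longrightarrow>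
     (\<lambda>n. complex_of_real (B n) / fact n * of_real t ^ n) sums
       (of_real t * koshliakov_sigma p (of_real t))"
  shows "gen_bernoulli2 p = B"
  unfolding gen_bernoulli2_def
proof (rule the_equality)
  show "\<forall>t. 0 < t \<and> t < 1 \<longrightarrow> (\<lambda>n. complex_of_real (B n) / fact n * of_real t ^ n) sums
       (of_real t * koshliakov_sigma p (of_real t))"
    using assms by blast
  fix B'
  assume B': "\<forall>t. 0 < t \<and> t < 1 \<longrightarrow> (\<lambda>n. complex_of_real (B' n) / fact n * of_real t ^ n) sums
       (of_real t * koshliakov_sigma p (of_real t))"
  have re: "(\<lambda>n. b n / fact n * t ^ n) sums Re z"
    if "(\<lambda>n. complex_of_real (b n) / fact n * of_real t ^ n) sums z" for b :: "nat \<Rightarrow> real" and t z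
  proof -
    have "(\<lambda>n. Re (complex_of_real (b n) / fact n * of_real t ^ n)) sums Re z"
      using that by (rule sums_Re)
    moreover have "complex_of_real (b n) / fact n * of_real t ^ n = of_real (b n / fact n * t ^ n)" for n
      by simp
    ultimately show ?thesis by (simp only: Re_complex_of_real)
  qed
  have "(\<lambda>n. B' n / fact n) = (\<lambda>n. B n / fact n)"
    by (rule powser_unique_on_unit_interval[of _ "\<lambda>t. Re (of_real t * koshliakov_sigma p (of_real t))"])
       (use re assms B' in blast)+
  then show "B' = B"
    by (simp add: fun_eq_iff)
qed

section \<open>Mellin transforms and their continuation\<close>

lemma set_integrable_dominated:
  fixes f :: "real \<Rightarrow> 'a::{banach, second_countable_topology}"
  assumes "continuous_on A f" "A \<in> sets borel" "set_integrable lborel A g"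
      and "\<And>x. x \<in> A \<Longrightarrow> norm (f x) \<le> (g x :: real)"
  shows "set_integrable lborel A f"
proof (rule set_integrable_bound[OF assms(3)])
  show "set_borel_measurable lborel A f"
    unfolding set_borel_measurable_def
    using borel_measurable_continuous_on_indicator[OF assms(2,1)] by simp
  show "AE x in lborel. x \<in> A \<longrightarrow> norm (f x) \<le> norm (g x)"
    using assms(4) by (intro AE_I2) fastforce
qed

lemma norm_of_real_powr:
  assumes "t > 0"
  shows "norm (complex_of_real t powr s) = t powr Re s"
  using assms by (subst norm_powr_real_powr) auto

lemma continuous_on_of_real_powr:
  "continuous_on {0<..} (\<lambda>t. complex_of_real t powr s)"
  by (intro continuous_intros) auto

lemma Gamma_integral_scaled:
  assumes "Re s > 0" "b > 0"
  shows "set_integrable lborel {0<..} (\<lambda>t. of_real (exp (- (b * t))) * complex_of_real t powr (s - 1))"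
    and "(LBINT t:{0<..}. of_real (exp (- (b * t))) * complex_of_real t powr (s - 1)) = Gamma s / of_real b powr s"
proof -
  define G where "G = (\<lambda>t. of_real (exp (- t)) * complex_of_real t powr (s - 1))"
  have G_eq: "G t = complex_of_real t powr (s - 1) / of_real (exp t)" for t
    by (simp add: G_def exp_minus field_simps)
  have meas: "(\<lambda>x. indicator {0<..} x *\<^sub>R G x) \<in> borel_measurable lborel"
    using borel_measurable_continuous_on_indicator[of "{0<..}" G] continuous_on_of_real_powr[of "s - 1"]
    unfolding G_def by (auto intro!: continuous_intros)
  have "G absolutely_integrable_on {0<..}"
    unfolding G_eq by (rule absolutely_integrable_Gamma_integral') (use assms in auto)
  then have int: "set_integrable lborel {0<..} G"
    using meas unfolding set_integrable_def by (simp add: integrable_completion)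
  have val: "(LBINT t:{0<..}. G t) = Gamma s"
    using set_borel_integral_eq_integral(2)[OF int] Gamma_integral_complex'[OF assms(1)]
    unfolding G_eq by (simp add: integral_unique)
  define H where "H = (\<lambda>t. indicator {0<..} t *\<^sub>R (of_real (exp (- (b * t))) * complex_of_real t powr (s - 1)))"
  have scale: "indicator {0<..} (0 + b * t) *\<^sub>R G (0 + b * t) = of_real b powr (s - 1) * H t" for t
    using assms(2)
    by (auto simp: G_def H_def indicator_def zero_less_mult_iff powr_times_real)
  have bnz: "complex_of_real b powr (s - 1) \<noteq> 0" using assms(2) by simp
  have "integrable lborel (\<lambda>t. of_real b powr (s - 1) * H t)"
    using lborel_integrable_real_affine[OF int[unfolded set_integrable_def], of b 0] assms(2)
    unfolding scale by auto
  then have "integrable lborel (\<lambda>t. inverse (of_real b powr (s - 1)) * (of_real b powr (s - 1) * H t))"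
    by (rule integrable_mult_right)
  moreover have "(\<lambda>t. inverse (of_real b powr (s - 1)) * (of_real b powr (s - 1) * H t)) = H"
    by (rule ext, subst mult.assoc[symmetric], subst left_inverse[OF bnz]) (rule mult_1_left)
  ultimately show "set_integrable lborel {0<..} (\<lambda>t. of_real (exp (- (b * t))) * complex_of_real t powr (s - 1))"
    unfolding set_integrable_def H_def by metis
  have "Gamma s = b *\<^sub>R (LBINT t. of_real b powr (s - 1) * H t)"
    using val lborel_integral_real_affine[of b "\<lambda>t. indicator {0<..} t *\<^sub>R G t" 0] assms(2)
    unfolding set_lebesgue_integral_def scale by simp
  also have "\<dots> = of_real b * complex_of_real b powr (s - 1) * (LBINT t. H t)"
    by (simp add: scaleR_conv_of_real)
  also have "of_real b * complex_of_real b powr (s - 1) = of_real b powr s"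
    using assms(2) by (simp add: powr_diff)
  finally have "Gamma s = of_real b powr s * (LBINT t. H t)" .
  then show "(LBINT t:{0<..}. of_real (exp (- (b * t))) * complex_of_real t powr (s - 1)) = Gamma s / of_real b powr s"
    unfolding set_lebesgue_integral_def H_def[symmetric] using assms(2) by simp
qed

lemma Gamma_integral_scaled_real:
  fixes x b :: real
  assumes "x > 0" "b > 0"
  shows "set_integrable lborel {0<..} (\<lambda>t. exp (- (b * t)) * t powr (x - 1))"
    and "(LBINT t:{0<..}. exp (- (b * t)) * t powr (x - 1)) = Gamma x / b powr x"
proof -
  have eq: "indicator {0<..} t *\<^sub>R (of_real (exp (- (b * t))) * complex_of_real t powr (of_real x - 1)) =
       complex_of_real (indicator {0<..} t *\<^sub>R (exp (- (b * t)) * t powr (x - 1)))" for t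
    using powr_of_real[of t "x - 1"] by (simp add: indicator_def)
  have "Re (of_real x) > 0" using assms by simp
  note G = Gamma_integral_scaled[OF this assms(2)]
  show "set_integrable lborel {0<..} (\<lambda>t. exp (- (b * t)) * t powr (x - 1))"
    using G(1) unfolding set_integrable_def eq complex_of_real_integrable_eq .
  have "complex_of_real (LBINT t:{0<..}. exp (- (b * t)) * t powr (x - 1)) = of_real (Gamma x / b powr x)"
    using G(2) assms unfolding set_lebesgue_integral_def eq integral_complex_of_real
    by (simp add: powr_of_real Gamma_complex_of_real)
  then show "(LBINT t:{0<..}. exp (- (b * t)) * t powr (x - 1)) = Gamma x / b powr x"
    by (simp only: of_real_eq_iff)
qed

lemma set_integrable_powr_exp_tail:
  fixes r b c :: real
  assumes "b > 0" "c > 0"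
  shows "set_integrable lborel {c..} (\<lambda>t. t powr r * exp (- (b * t)))"
proof -
  define r' where "r' = max r 0"
  have "set_integrable lborel {0<..} (\<lambda>t. exp (- (b * t)) * t powr (r' + 1 - 1))"
    using assms by (intro Gamma_integral_scaled_real) (auto simp: r'_def)
  then have "set_integrable lborel {c..} (\<lambda>t. exp (- (b * t)) * t powr (r' + 1 - 1))"
    by (rule set_integrable_subset) (use assms in auto)
  then have "set_integrable lborel {c..} (\<lambda>t. c powr (r - r') * (exp (- (b * t)) * t powr (r' + 1 - 1)))"
    by (rule set_integrable_mult_right)
  then show ?thesis
  proof (rule set_integrable_dominated[rotated 2])
    show "continuous_on {c..} (\<lambda>t. t powr r * exp (- (b * t)))"
      using assms by (intro continuous_intros) auto
    fix t assume t: "t \<in> {c..}"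
    have "(t / c) powr r \<le> (t / c) powr r'"
      using assms t by (intro powr_mono) (auto simp: r'_def)
    then have "t powr r \<le> c powr (r - r') * t powr r'"
      using assms t by (simp add: powr_divide powr_diff field_simps)
    then show "norm (t powr r * exp (- (b * t))) \<le> c powr (r - r') * (exp (- (b * t)) * t powr (r' + 1 - 1))"
      using mult_right_mono[of "t powr r" "c powr (r - r') * t powr r'" "exp (- (b * t))"]
      by (simp add: mult_ac)
  qed simp
qed

lemma Mellin_tail_integrable:
  fixes h :: "real \<Rightarrow> complex"
  assumes h: "continuous_on {c..} h" and c: "c > 0" and b: "b > 0"
      and decay: "\<And>t. t \<ge> c \<Longrightarrow> norm (h t) \<le> C * exp (- (b * t))"
  shows "set_integrable lborel {c..} (\<lambda>t. h t * of_real t powr (s - 1))"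
proof (rule set_integrable_dominated)
  show "continuous_on {c..} (\<lambda>t. h t * of_real t powr (s - 1))"
    using h c by (intro continuous_intros continuous_on_subset[OF continuous_on_of_real_powr]) auto
  show "set_integrable lborel {c..} (\<lambda>t. C * (t powr (Re s - 1) * exp (- (b * t))))"
    by (intro set_integrable_mult_right set_integrable_powr_exp_tail b c)
  fix t assume "t \<in> {c..}"
  then have t: "t \<ge> c" "t > 0" using c by auto
  have "norm (h t * of_real t powr (s - 1)) = norm (h t) * t powr (Re s - 1)"
    using t by (simp add: norm_mult norm_of_real_powr)
  also have "\<dots> \<le> (C * exp (- (b * t))) * t powr (Re s - 1)"
    by (intro mult_right_mono decay t) simp
  finally show "norm (h t * of_real t powr (s - 1)) \<le> C * (t powr (Re s - 1) * exp (- (b * t)))"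
    by (simp only: mult_ac)
qed simp

text \<open>
  On a compact interval away from \<open>0\<close> the integral can be differentiated under the integral sign;
  the tail of the Mellin transform is then a locally uniform limit of such integrals.
\<close>
lemma Mellin_truncated_holomorphic:
  fixes h :: "real \<Rightarrow> complex"
  assumes h: "continuous_on {a..b} h" and a: "a > 0"
  shows "(\<lambda>s. LBINT t:{a..b}. h t * of_real t powr (s - 1)) holomorphic_on UNIV"
proof -
  have powr: "complex_of_real t powr (s - 1) = exp ((s - 1) * of_real (ln t))" if "t \<in> {a..b}" for t s
    using that a by (simp add: powr_def Ln_of_real)
  have cont: "continuous_on {a..b} (\<lambda>t. h t * exp ((s - 1) * of_real (ln t)))" for s
    using a by (intro continuous_intros h) auto
  have "(\<lambda>s. integral (cbox a b) (\<lambda>t. h t * exp ((s - 1) * of_real (ln t)))) holomorphic_on UNIV"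
  proof (rule leibniz_rule_holomorphic)
    show "((\<lambda>s. h t * exp ((s - 1) * of_real (ln t))) has_field_derivative
       h t * (exp ((s - 1) * of_real (ln t)) * of_real (ln t))) (at s within UNIV)" for s t
      by (auto intro!: derivative_eq_intros)
    show "(\<lambda>t. h t * exp ((s - 1) * of_real (ln t))) integrable_on cbox a b" for s
      unfolding cbox_interval by (rule integrable_continuous_real[OF cont])
    have "continuous_on (UNIV \<times> {a..b}) (h \<circ> snd)"
      using h by (intro continuous_on_compose continuous_intros)
        (auto intro: continuous_on_subset)
    then have "continuous_on (UNIV \<times> {a..b}) (\<lambda>x. h (snd x))" by (simp add: o_def)
    then show "continuous_on (UNIV \<times> cbox a b)
       (\<lambda>(s, t). h t * (exp ((s - 1) * complex_of_real (ln t)) * of_real (ln t)))"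
      unfolding cbox_interval case_prod_beta using a by (intro continuous_intros) auto
  qed simp
  moreover have "(LBINT t:{a..b}. h t * of_real t powr (s - 1)) =
      integral (cbox a b) (\<lambda>t. h t * exp ((s - 1) * of_real (ln t)))" for s
  proof -
    have "(LBINT t:{a..b}. h t * of_real t powr (s - 1)) = (LBINT t:{a..b}. h t * exp ((s - 1) * of_real (ln t)))"
      by (intro set_lebesgue_integral_cong) (auto simp: powr)
    also have "\<dots> = integral {a..b} (\<lambda>t. h t * exp ((s - 1) * of_real (ln t)))"
      by (intro set_borel_integral_eq_integral borel_integrable_atLeastAtMost' cont)
    finally show ?thesis by simp
  qed
  ultimately show ?thesis by simp
qed

text \<open>
  The part of a Mellin transform away from \<open>0\<close> is entire: for \<open>s\<close> in a disc of radius \<open>1\<close> one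
  integrable function dominates all integrands, so the truncated integrals converge uniformly.
\<close>
lemma Mellin_tail_holomorphic:
  fixes h :: "real \<Rightarrow> complex"
  assumes h: "continuous_on {c..} h" and c: "c > 0" and b: "b > 0"
      and decay: "\<And>t. t \<ge> c \<Longrightarrow> norm (h t) \<le> C * exp (- (b * t))"
  shows "(\<lambda>s. LBINT t:{c..}. h t * of_real t powr (s - 1)) holomorphic_on UNIV"
proof (rule holomorphic_uniform_sequence)
  define F where "F = (\<lambda>n s. LBINT t:{c..c + real n}. h t * of_real t powr (s - 1))"
  show "F n holomorphic_on UNIV" for n
    unfolding F_def using h c by (intro Mellin_truncated_holomorphic) (auto intro: continuous_on_subset)
  fix x :: complex
  define g where "g = (\<lambda>t. C * (t powr Re x * exp (- (b * t))) + C * (t powr (Re x - 2) * exp (- (b * t))))"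
  have g_int: "set_integrable lborel {c..} g"
    unfolding g_def by (intro set_integral_add set_integrable_mult_right set_integrable_powr_exp_tail b c)
  have dom: "norm (h t * of_real t powr (s - 1)) \<le> g t" if "s \<in> cball x 1" "t \<ge> c" for s t
  proof -
    have "\<bar>Re (x - s)\<bar> \<le> 1"
      using that(1) abs_Re_le_cmod[of "x - s"] by (simp add: dist_norm)
    then have re: "Re x - 2 \<le> Re s - 1" "Re s - 1 \<le> Re x" by (auto simp: abs_le_iff)
    have t: "t > 0" using that c by simp
    \<comment> \<open>The exponent \<open>Re s - 1\<close> lies between \<open>Re x - 2\<close> and \<open>Re x\<close>; the first term dominates for \<open>t \<ge> 1\<close>, the second for \<open>t < 1\<close>.\<close>
    have "t powr (Re s - 1) \<le> t powr Re x + t powr (Re x - 2)"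
    proof (cases "t \<ge> 1")
      case True
      then have "t powr (Re s - 1) \<le> t powr Re x" using re by (intro powr_mono)
      then show ?thesis by (simp add: add_increasing2)
    next
      case False
      then have "t powr (Re s - 1) \<le> t powr (Re x - 2)" using re t by (intro powr_mono') auto
      then show ?thesis by (simp add: add_increasing)
    qed
    moreover have "0 \<le> C * exp (- (b * t))" using order_trans[OF norm_ge_zero decay[OF that(2)]] .
    ultimately have "norm (h t) * t powr (Re s - 1) \<le> C * exp (- (b * t)) * (t powr Re x + t powr (Re x - 2))"
      using decay[OF that(2)] by (intro mult_mono) auto
    then show ?thesis
      using t unfolding norm_mult norm_of_real_powr[OF t] g_def
      by (simp only: minus_complex.simps one_complex.simps distrib_left mult_ac)
  qed
  have un: "{c..} = {c..c + real n} \<union> {c + real n<..}" for n by auto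
  have lim: "(\<lambda>n. LBINT t:{c + real n<..}. g t) \<longlonglongrightarrow> 0"
  proof -
    have "((\<lambda>d. LBINT t:{c..d}. g t) \<longlongrightarrow> (LBINT t:{c..}. g t)) at_top"
      by (rule tendsto_set_lebesgue_integral_at_top) (use g_int in auto)
    then have "(\<lambda>n. LBINT t:{c..c + real n}. g t) \<longlonglongrightarrow> (LBINT t:{c..}. g t)"
      by (rule filterlim_compose) 
        (intro filterlim_tendsto_add_at_top[OF tendsto_const] filterlim_real_sequentially)
    then have "(\<lambda>n. (LBINT t:{c..}. g t) - (LBINT t:{c..c + real n}. g t)) \<longlonglongrightarrow> (LBINT t:{c..}. g t) - (LBINT t:{c..}. g t)"
      by (intro tendsto_intros)
    moreover have "(LBINT t:{c..}. g t) - (LBINT t:{c..c + real n}. g t) = (LBINT t:{c + real n<..}. g t)" for n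
      by (subst un[of n], subst set_integral_Un) (auto intro!: set_integrable_subset[OF g_int])
    ultimately show ?thesis by simp
  qed
  have "uniform_limit (cball x 1) F (\<lambda>s. LBINT t:{c..}. h t * of_real t powr (s - 1)) sequentially"
  proof (rule uniform_limitI)
    fix e :: real assume "e > 0"
    then have "eventually (\<lambda>n. (LBINT t:{c + real n<..}. g t) < e) sequentially"
      using lim by (rule order_tendstoD(2)[rotated])
    then show "\<forall>\<^sub>F n in sequentially. \<forall>s\<in>cball x 1.
        dist (F n s) (LBINT t:{c..}. h t * of_real t powr (s - 1)) < e"
    proof eventually_elim
      case (elim n)
      show ?case
      proof
        fix s assume s: "s \<in> cball x 1"
        note int = Mellin_tail_integrable[OF h c b decay, of s]
        have int_n: "set_integrable lborel {c + real n<..} (\<lambda>t. h t * of_real t powr (s - 1))"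
          by (rule set_integrable_subset[OF int]) auto
        have diff: "(LBINT t:{c..}. h t * of_real t powr (s - 1)) - F n s =
                 (LBINT t:{c + real n<..}. h t * of_real t powr (s - 1))"
          unfolding F_def
          by (subst un[of n], subst set_integral_Un) (auto intro!: set_integrable_subset[OF int])
        have le1: "norm (LBINT t:{c + real n<..}. h t * of_real t powr (s - 1)) \<le>
             (LBINT t:{c + real n<..}. norm (h t * of_real t powr (s - 1)))"
          by (rule set_integral_norm_bound[OF int_n])
        have le2: "(LBINT t:{c + real n<..}. norm (h t * of_real t powr (s - 1))) \<le> (LBINT t:{c + real n<..}. g t)"
          by (rule set_integral_mono)
             (use dom[OF s] in \<open>auto intro!: set_integrable_norm int_n set_integrable_subset[OF g_int]\<close>)
        have "norm ((LBINT t:{c..}. h t * of_real t powr (s - 1)) - F n s) < e"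
          unfolding diff using order_trans[OF le1 le2] elim by (rule le_less_trans)
        then show "dist (F n s) (LBINT t:{c..}. h t * of_real t powr (s - 1)) < e"
          by (metis dist_norm dist_commute)
      qed
    qed
  qed
  then show "\<exists>d>0. cball x d \<subseteq> UNIV \<and> uniform_limit (cball x d) F
      (\<lambda>s. LBINT t:{c..}. h t * of_real t powr (s - 1)) sequentially"
    by (intro exI[of _ 1]) auto
qed simp

lemma powr_integral_head:
  assumes z: "Re z > 0" and c: "c > 0"
  shows "set_integrable lborel {0<..<c} (\<lambda>t. complex_of_real t powr (z - 1))"
    and "(LBINT t:{0<..<c}. complex_of_real t powr (z - 1)) = of_real c powr z / z"
    and "(LBINT t:{0<..<c}. norm (complex_of_real t powr (z - 1))) = c powr Re z / Re z"
proof -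
  have cont: "continuous_on {0<..<c} (\<lambda>t. complex_of_real t powr (z - 1))"
    by (rule continuous_on_subset[OF continuous_on_of_real_powr]) auto
  have real_int: "((\<lambda>t. t powr (Re z - 1)) has_integral (c powr Re z / Re z)) {0..c}"
    using has_integral_powr_from_0[of "Re z - 1" c] z c by simp
  have real_int': "((\<lambda>t. norm (complex_of_real t powr (z - 1))) has_integral (c powr Re z / Re z)) {0<..<c}"
  proof -
    have "((\<lambda>t. t powr (Re z - 1)) has_integral (c powr Re z / Re z)) {0<..<c}"
      using real_int by (simp add: has_integral_Icc_iff_Ioo)
    then show ?thesis
      by (rule has_integral_eq[rotated]) (auto simp: norm_of_real_powr)
  qed
  have meas: "(\<lambda>t. indicator {0<..<c} t *\<^sub>R complex_of_real t powr (z - 1)) \<in> borel_measurable lborel"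
    using borel_measurable_continuous_on_indicator[OF _ cont] by simp
  have complex_int: "((\<lambda>t. complex_of_real t powr (z - 1)) has_integral (of_real c powr z / z)) {0<..<c}"
  proof -
    have "((\<lambda>t. complex_of_real t powr (z - 1)) has_integral (of_real c powr z / z - of_real 0 powr z / z)) {0..c}"
    proof (rule fundamental_theorem_of_calculus_interior)
      show "continuous_on {0..c} (\<lambda>t. complex_of_real t powr z / z)"
        using z by (intro continuous_intros) auto
      show "((\<lambda>t. complex_of_real t powr z / z) has_vector_derivative of_real t powr (z - 1)) (at t)"
        if "t \<in> {0<..<c}" for t
        using that z by (auto intro!: derivative_eq_intros has_vector_derivative_real_field)
    qed (use c in simp)
    then show ?thesis
      by (simp add: has_integral_Icc_iff_Ioo)
  qed
  have "(\<lambda>t. complex_of_real t powr (z - 1)) absolutely_integrable_on {0<..<c}"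
    using complex_int real_int' unfolding absolutely_integrable_on_def integrable_on_def by blast
  then show int: "set_integrable lborel {0<..<c} (\<lambda>t. complex_of_real t powr (z - 1))"
    using meas unfolding set_integrable_def by (simp add: integrable_completion)
  show "(LBINT t:{0<..<c}. complex_of_real t powr (z - 1)) = of_real c powr z / z"
    using set_borel_integral_eq_integral(2)[OF int] complex_int by (simp add: integral_unique)
  show "(LBINT t:{0<..<c}. norm (complex_of_real t powr (z - 1))) = c powr Re z / Re z"
    using set_borel_integral_eq_integral(2)[OF set_integrable_norm[OF int]] real_int' by (simp add: integral_unique)
qed

text \<open>
  Near \<open>0\<close> the function is \<open>\<Sum>n. a n t\<^bsup>n-1\<^esup>\<close>, and termwise integration of \<open>a n t\<^bsup>s+n-2\<^esup>\<close> over \<open>(0, c)\<close>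
  produces one pole for each \<open>n\<close>, at \<open>s = 1 - n\<close>.
\<close>
lemma Mellin_head_sums:
  fixes h :: "real \<Rightarrow> complex" and a :: "nat \<Rightarrow> complex"
  assumes c: "c > 0"
      and ser: "\<And>t. 0 < t \<Longrightarrow> t < c \<Longrightarrow> (\<lambda>n. a n * of_real t ^ n) sums (of_real t * h t)"
      and summ: "summable (\<lambda>n. norm (a n) * c ^ n)"
      and s: "Re s > 1"
  shows "set_integrable lborel {0<..<c} (\<lambda>t. h t * of_real t powr (s - 1))"
    and "(\<lambda>n. a n * (of_real c powr (s + of_nat n - 1) / (s + of_nat n - 1))) sums
           (LBINT t:{0<..<c}. h t * of_real t powr (s - 1))"
proof -
  define f where "f = (\<lambda>n t. indicator {0<..<c} t *\<^sub>R (a n * complex_of_real t powr (s + of_nat n - 1 - 1)))"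
  have Re_pos: "Re (s + of_nat n - 1) > 0" for n using s by simp
  note head = powr_integral_head[OF Re_pos c]
  have f_alt: "f n t = a n * (indicator {0<..<c} t *\<^sub>R (complex_of_real t powr (s + of_nat n - 1 - 1)))" for n t
    by (simp add: f_def)
  have f_sums: "(\<lambda>n. f n t) sums (indicator {0<..<c} t *\<^sub>R (h t * of_real t powr (s - 1)))" for t
  proof (cases "t \<in> {0<..<c}")
    case True
    then have t: "0 < t" "t < c" by auto
    have "(\<lambda>n. a n * of_real t ^ n * of_real t powr (s - 2)) sums (of_real t * h t * of_real t powr (s - 2))"
      by (intro sums_mult2 ser t)
    moreover have "f n t = a n * of_real t ^ n * of_real t powr (s - 2)" for n
    proof -
      have "complex_of_real t powr (s + of_nat n - 1 - 1) = of_real t powr (of_nat n + (s - 2))"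
        by (simp add: algebra_simps)
      also have "\<dots> = of_real t ^ n * of_real t powr (s - 2)"
        using t by (subst powr_add) (simp add: powr_nat)
      finally show ?thesis
        using True by (simp add: f_def)
    qed
    moreover have "of_real t * h t * of_real t powr (s - 2) = h t * of_real t powr (s - 1)"
    proof -
      have "of_real t * of_real t powr (s - 2) = complex_of_real t powr (s - 1)"
        using t powr_add[of "complex_of_real t" 1 "s - 2"] by simp
      then show ?thesis by (metis mult.assoc mult.commute)
    qed
    ultimately show ?thesis
      using True by (simp only: indicator_simps scaleR_one)
  next
    case False
    then show ?thesis by (simp add: f_def)
  qed
  have f_int: "integrable lborel (f n)" for n
    unfolding f_alt using head(1)[of n] unfolding set_integrable_def by (rule integrable_mult_right)
  have f_val: "(LBINT t. f n t) = a n * (of_real c powr (s + of_nat n - 1) / (s + of_nat n - 1))" for n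
    unfolding f_alt integral_mult_right_zero head(2)[of n, unfolded set_lebesgue_integral_def] by (rule refl)
  have norm_val: "(LBINT t. norm (f n t)) = norm (a n) * (c powr (Re s + real n - 1) / (Re s + real n - 1))" for n
  proof -
    have "norm (f n t) = norm (a n) * (indicator {0<..<c} t *\<^sub>R norm (complex_of_real t powr (s + of_nat n - 1 - 1)))" for t
      by (simp add: f_alt norm_mult)
    then show ?thesis
      using head(3)[of n] by (simp add: set_lebesgue_integral_def)
  qed
  have pt_summ: "summable (\<lambda>n. norm (f n t))" for t
  proof (cases "t \<in> {0<..<c}")
    case True
    then have t: "0 < t" "t < c" by auto
    have "norm (f n t) \<le> norm (a n) * c ^ n * t powr (Re s - 2)" for n
    proof -
      have "norm (f n t) = norm (a n) * t powr (real n + (Re s - 2))"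
        using True t by (simp add: f_def norm_mult norm_of_real_powr algebra_simps)
      also have "\<dots> = norm (a n) * t ^ n * t powr (Re s - 2)"
        using t by (simp add: powr_add powr_realpow)
      also have "\<dots> \<le> norm (a n) * c ^ n * t powr (Re s - 2)"
        using t by (intro mult_right_mono mult_left_mono power_mono) auto
      finally show ?thesis .
    qed
    then show ?thesis
      by (intro summable_comparison_test'[OF summable_mult2[OF summ, of "t powr (Re s - 2)"]]) auto
  qed (simp add: f_def)
  have norm_summ: "summable (\<lambda>n. LBINT t. norm (f n t))"
  proof (rule summable_comparison_test'[OF summable_mult2[OF summ, of "c powr (Re s - 1) / (Re s - 1)"]])
    fix n :: nat
    have "Re s + real n - 1 = real n + (Re s - 1)" by simp
    then have pw: "c powr (Re s + real n - 1) = c ^ n * c powr (Re s - 1)"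
      using c powr_add[of c "real n" "Re s - 1"] by (simp only: powr_realpow)
    have "c powr (Re s + real n - 1) / (Re s + real n - 1) \<le> c ^ n * c powr (Re s - 1) / (Re s - 1)"
      unfolding pw using s c by (intro divide_left_mono) (auto intro!: mult_pos_pos)
    then have "norm (a n) * (c powr (Re s + real n - 1) / (Re s + real n - 1)) \<le>
        norm (a n) * (c ^ n * c powr (Re s - 1) / (Re s - 1))"
      by (intro mult_left_mono) auto
    then show "norm (LBINT t. norm (f n t)) \<le> norm (a n) * c ^ n * (c powr (Re s - 1) / (Re s - 1))"
      unfolding norm_val using s by (simp add: mult.assoc)
  qed
  have sum_eq: "(\<lambda>t. \<Sum>n. f n t) = (\<lambda>t. indicator {0<..<c} t *\<^sub>R (h t * of_real t powr (s - 1)))"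
    using f_sums by (auto simp: sums_iff)
  have AE: "AE t in lborel. summable (\<lambda>n. norm (f n t))" using pt_summ by simp
  show "set_integrable lborel {0<..<c} (\<lambda>t. h t * of_real t powr (s - 1))"
    using integrable_suminf[OF f_int AE norm_summ] unfolding sum_eq set_integrable_def .
  show "(\<lambda>n. a n * (of_real c powr (s + of_nat n - 1) / (s + of_nat n - 1))) sums
           (LBINT t:{0<..<c}. h t * of_real t powr (s - 1))"
    using sums_integral[OF f_int AE norm_summ] unfolding sum_eq set_lebesgue_integral_def f_val .
qed

text \<open>
  This is the entire function \<open>1 / (\<Gamma>(s) (s + k))\<close>: the zero of \<open>1 / \<Gamma>\<close> at \<open>-k\<close> cancels the pole. Writing
  it with a Pochhammer symbol gives the right value at \<open>-k\<close> as well.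
\<close>
definition rGamma_quotient :: "nat \<Rightarrow> complex \<Rightarrow> complex" where
  "rGamma_quotient k s = pochhammer s k * rGamma (s + of_nat k + 1)"

lemma rGamma_quotient_mult: "(s + of_nat k) * rGamma_quotient k s = rGamma s"
  using pochhammer_rGamma[of s "Suc k"]
  by (simp add: rGamma_quotient_def pochhammer_Suc algebra_simps)

text \<open>
  Among these functions only the one with index \<open>m\<close> survives at \<open>-m\<close>, because there its pole meets the
  zero of \<open>1 / \<Gamma>\<close>. This is what isolates a single coefficient in the continuation below.
\<close>
lemma rGamma_quotient_minus_of_nat:
  "rGamma_quotient k (- of_nat m) = (if k = m then (-1) ^ m * fact m else 0)"
proof (cases "k = m")
  case True
  then show ?thesis by (simp add: rGamma_quotient_def pochhammer_same)
next
  case False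
  have "(- of_nat m + of_nat k) * rGamma_quotient k (- of_nat m) = (0 :: complex)"
    unfolding rGamma_quotient_mult by (simp add: rGamma_eq_zero_iff)
  moreover have "- of_nat m + of_nat k \<noteq> (0 :: complex)"
    using False by (metis add.commute add_eq_0_iff2 minus_minus of_nat_eq_iff)
  ultimately show ?thesis using False by simp
qed

lemma rGamma_quotient_holomorphic: "rGamma_quotient k holomorphic_on A"
proof -
  have "(\<lambda>s. pochhammer s k * rGamma (s + of_nat k + 1)) holomorphic_on A"
    unfolding pochhammer_prod by (intro holomorphic_intros)
  then show ?thesis
    by (simp add: rGamma_quotient_def[abs_def])
qed

text \<open>
  On a disc all but finitely many \<open>k\<close> satisfy \<open>\<bar>s + k\<bar> \<ge> 1\<close>, and for those \<open>k\<close> the functions are bounded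
  by \<open>\<bar>1 / \<Gamma>(s)\<bar>\<close>; the convergence is therefore locally uniform.
\<close>
lemma rGamma_quotient_series_holomorphic:
  fixes d :: "nat \<Rightarrow> complex"
  assumes "summable (\<lambda>k. norm (d k))"
  shows "(\<lambda>s. \<Sum>k. d k * rGamma_quotient k s) holomorphic_on UNIV"
proof (rule holomorphic_uniform_sequence)
  show "(\<lambda>s. \<Sum>k<n. d k * rGamma_quotient k s) holomorphic_on UNIV" for n
    by (intro holomorphic_intros rGamma_quotient_holomorphic)
  fix x :: complex
  have "bounded (rGamma ` cball x 1)"
    by (intro compact_imp_bounded compact_continuous_image continuous_on_rGamma) auto
  then obtain M where M: "\<And>s. s \<in> cball x 1 \<Longrightarrow> norm (rGamma s) \<le> M"
    unfolding bounded_iff by blast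
  have "eventually (\<lambda>k. real k \<ge> norm x + 2) sequentially"
    using filterlim_real_sequentially unfolding filterlim_at_top by blast
  then have "eventually (\<lambda>k. \<forall>s\<in>cball x 1. norm (d k * rGamma_quotient k s) \<le> norm (d k) * M) sequentially"
  proof eventually_elim
    case (elim k)
    show ?case
    proof
      fix s assume s: "s \<in> cball x 1"
      have "norm s \<le> norm x + 1"
        using s norm_triangle_ineq2[of s x] by (simp add: dist_norm norm_minus_commute)
      moreover have "norm (complex_of_nat k) - norm (- s) \<le> norm (of_nat k - (- s))"
        by (rule norm_triangle_ineq2)
      ultimately have ge: "1 \<le> norm (s + of_nat k)"
        using elim by (simp add: add.commute)
      have "norm (rGamma_quotient k s) \<le> norm (s + of_nat k) * norm (rGamma_quotient k s)"
        using mult_right_mono[OF ge norm_ge_zero[of "rGamma_quotient k s"]] by simp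
      also have "\<dots> = norm (rGamma s)"
        by (simp add: rGamma_quotient_mult flip: norm_mult)
      also have "\<dots> \<le> M" by (rule M[OF s])
      finally show "norm (d k * rGamma_quotient k s) \<le> norm (d k) * M"
        by (simp add: norm_mult mult_left_mono)
    qed
  qed
  then have "uniform_limit (cball x 1) (\<lambda>n s. \<Sum>k<n. d k * rGamma_quotient k s)
      (\<lambda>s. \<Sum>k. d k * rGamma_quotient k s) sequentially"
    by (rule Weierstrass_m_test_ev) (intro summable_mult2 assms)
  then show "\<exists>r>0. cball x r \<subseteq> UNIV \<and> uniform_limit (cball x r)
     (\<lambda>n s. \<Sum>k<n. d k * rGamma_quotient k s) (\<lambda>s. \<Sum>k. d k * rGamma_quotient k s) sequentially"
    by (intro exI[of _ 1]) auto
qed simp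

text \<open>
  Split the integral at \<open>c\<close>. The tail is entire, and the head is a series of simple fractions in \<open>s\<close>
  with poles at \<open>1, 0, -1, \<dots>\<close>. The factor \<open>1 / \<Gamma>\<close> cancels all of them but the first, so that
  \<open>s - 1\<close> times the whole is an entire function \<open>E\<close>. At \<open>-m\<close> the tail is killed by \<open>1 / \<Gamma>\<close>, and only
  the coefficient \<open>a (m + 1)\<close> contributes.
\<close>
theorem Mellin_continuation:
  fixes h :: "real \<Rightarrow> complex" and a :: "nat \<Rightarrow> complex"
  assumes h: "continuous_on {0<..} h"
      and c: "c > 0" and b: "b > 0"
      and decay: "\<And>t. t \<ge> c \<Longrightarrow> norm (h t) \<le> C * exp (- (b * t))"
      and ser: "\<And>t. 0 < t \<Longrightarrow> t < c \<Longrightarrow> (\<lambda>n. a n * of_real t ^ n) sums (of_real t * h t)"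
      and summ: "summable (\<lambda>n. norm (a n) * c ^ n)"
  obtains E where "E holomorphic_on UNIV"
    "\<And>s. Re s > 1 \<Longrightarrow> rGamma s * (LBINT t:{0<..}. h t * of_real t powr (s - 1)) = E s / (s - 1)"
    "\<And>m. E (- of_nat m) = (- of_nat m - 1) * ((-1) ^ m * fact m * a (Suc m))"
proof -
  have h': "continuous_on {c..} h"
    by (rule continuous_on_subset[OF h]) (use c in auto)
  define T where "T = (\<lambda>s. LBINT t:{c..}. h t * of_real t powr (s - 1))"
  define d where "d = (\<lambda>k. a (Suc k) * of_real c ^ Suc k)"
  define S where "S = (\<lambda>s. \<Sum>k. d k * rGamma_quotient k s)"
  define E where "E = (\<lambda>s. (s - 1) * rGamma s * T s + of_real c powr (s - 1) * (a 0 * rGamma s + (s - 1) * S s))"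
  have d_norm: "norm (d k) = norm (a (Suc k)) * c ^ Suc k" for k
    using c by (simp add: d_def norm_mult norm_power)
  have d_summ: "summable (\<lambda>k. norm (d k))"
    unfolding d_norm using summ by (subst summable_Suc_iff)
  have T_hol: "T holomorphic_on UNIV"
    unfolding T_def by (rule Mellin_tail_holomorphic[OF h' c b decay])
  have S_hol: "S holomorphic_on UNIV"
    unfolding S_def by (rule rGamma_quotient_series_holomorphic[OF d_summ])
  show thesis
  proof (rule that[of E])
    show "E holomorphic_on UNIV"
      unfolding E_def by (intro holomorphic_intros T_hol S_hol)
  next
    fix s :: complex assume s: "Re s > 1"
    then have s1: "s \<noteq> 1" by auto
    note head = Mellin_head_sums[OF c ser summ s]
    define I where "I = (LBINT t:{0<..<c}. h t * of_real t powr (s - 1))"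
    have un: "{0<..} = {0<..<c} \<union> {c..}" using c by auto
    have split: "(LBINT t:{0<..}. h t * of_real t powr (s - 1)) = I + T s"
      unfolding un I_def T_def
      by (rule set_integral_Un) (auto intro!: head(1) Mellin_tail_integrable[OF h' c b decay])
    define g where "g = (\<lambda>n. a n * (of_real c powr (s + of_nat n - 1) / (s + of_nat n - 1)))"
    have "g sums I"
      using head(2) by (simp add: g_def I_def)
    then have "(\<lambda>k. g (Suc k)) sums (I - g 0)"
      by (subst sums_Suc_iff) simp
    then have "(\<lambda>k. rGamma s * g (Suc k)) sums (rGamma s * (I - g 0))"
      by (rule sums_mult)
    moreover have "rGamma s * g (Suc k) = of_real c powr (s - 1) * (d k * rGamma_quotient k s)" for k
    proof -
      have nz: "s + of_nat k \<noteq> 0"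
      proof
        assume "s + of_nat k = 0"
        then have "Re (s + of_nat k) = 0" by simp
        with s show False by simp
      qed
      have "complex_of_real c powr (s + of_nat (Suc k) - 1) = of_real c powr (s - 1 + of_nat (Suc k))"
        by (simp add: algebra_simps)
      also have "\<dots> = of_real c powr (s - 1) * of_real c ^ Suc k"
        using c by (subst powr_add) (simp add: powr_nat del: of_nat_Suc)
      finally have "g (Suc k) = a (Suc k) * (of_real c powr (s - 1) * of_real c ^ Suc k) / (s + of_nat k)"
        by (simp add: g_def)
      moreover have "rGamma s / (s + of_nat k) = rGamma_quotient k s"
        using nz rGamma_quotient_mult[of s k] by (simp add: field_simps)
      ultimately show ?thesis
        by (simp add: d_def mult_ac divide_inverse)
    qed
    ultimately have "(\<lambda>k. of_real c powr (s - 1) * (d k * rGamma_quotient k s)) sums (rGamma s * (I - g 0))"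
      by simp
    from sums_divide[OF this, of "of_real c powr (s - 1)"]
    have "(\<lambda>k. d k * rGamma_quotient k s) sums (rGamma s * (I - g 0) / of_real c powr (s - 1))"
      using c by simp
    then have "S s = rGamma s * (I - g 0) / of_real c powr (s - 1)"
      unfolding S_def by (simp add: sums_iff)
    then have "rGamma s * I = rGamma s * g 0 + of_real c powr (s - 1) * S s"
      using c by (simp add: field_simps)
    moreover have "g 0 = a 0 * of_real c powr (s - 1) / (s - 1)"
      by (simp add: g_def)
    ultimately have "rGamma s * (I + T s) =
        rGamma s * (a 0 * of_real c powr (s - 1) / (s - 1)) + of_real c powr (s - 1) * S s + rGamma s * T s"
      by (simp add: distrib_left)
    also have "\<dots> = E s / (s - 1)"
      using s1 by (simp add: E_def field_simps)
    finally show "rGamma s * (LBINT t:{0<..}. h t * of_real t powr (s - 1)) = E s / (s - 1)"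
      unfolding split .
  next
    fix m :: nat
    have "(\<lambda>k. d k * rGamma_quotient k (- of_nat m)) sums (d m * ((-1) ^ m * fact m))"
      using sums_single[of m "\<lambda>k. d k * ((-1) ^ m * fact m)"]
      by (simp add: rGamma_quotient_minus_of_nat if_distrib cong: if_cong)
    then have "S (- of_nat m) = d m * ((-1) ^ m * fact m)"
      unfolding S_def by (simp add: sums_iff)
    moreover have "rGamma (- of_nat m :: complex) = 0"
      by (simp add: rGamma_eq_zero_iff)
    moreover have q: "complex_of_real c powr (- of_nat m - 1) * of_real c ^ Suc m = 1"
    proof -
      have "- of_nat m - 1 = - (of_nat (Suc m) :: complex)" by simp
      then show ?thesis
        using c by (simp add: powr_minus powr_nat del: of_nat_Suc power_Suc)
    qed
    ultimately have "E (- of_nat m) = (complex_of_real c powr (- of_nat m - 1) * of_real c ^ Suc m) *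
        ((- of_nat m - 1) * ((-1) ^ m * fact m * a (Suc m)))"
      unfolding E_def d_def by (simp only: mult_zero_left mult_zero_right add_0 mult_ac)
    then show "E (- of_nat m) = (- of_nat m - 1) * ((-1) ^ m * fact m * a (Suc m))"
      unfolding q by simp
  qed
qed

section \<open>Mellin transforms of exponential series\<close>

lemma exp_half_sums:
  assumes "(t::real) > 0"
  shows "(\<lambda>k. exp (- ((real k + 1/2) * t))) sums (exp (- t / 2) / (1 - exp (- t)))"
proof -
  have "(\<lambda>k. exp (- t / 2) * exp (- t) ^ k) sums (exp (- t / 2) * (1 / (1 - exp (- t))))"
    using assms by (intro sums_mult geometric_sums) simp
  moreover have "exp (- t / 2) * exp (- t) ^ k = exp (- ((real k + 1/2) * t))" for k
  proof -
    have "- ((real k + 1/2) * t) = - t / 2 + real k * (- t)"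
      by (simp add: algebra_simps)
    then show ?thesis by (simp only: exp_add exp_of_nat_mult)
  qed
  ultimately show ?thesis by simp
qed

lemma summable_half_shift_powr:
  assumes "(x::real) > 1"
  shows "summable (\<lambda>k. 1 / (real k + 1/2) powr x)"
proof -
  have "summable (\<lambda>k. real k powr (- x))"
    using assms by (subst summable_real_powr_iff) simp
  then have summ: "summable (\<lambda>k. real (Suc k) powr (- x))"
    by (subst summable_Suc_iff)
  have "norm (1 / (real (Suc k) + 1/2) powr x) \<le> real (Suc k) powr (- x)" for k
  proof -
    have "(real (Suc k) + 1/2) powr (- x) \<le> real (Suc k) powr (- x)"
      using assms by (intro powr_mono2') auto
    then show ?thesis
      by (simp add: powr_minus_divide)
  qed
  then have "summable (\<lambda>k. 1 / (real (Suc k) + 1/2) powr x)"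
    using summ by (rule summable_comparison_test'[rotated])
  then show ?thesis
    by (subst (asm) summable_Suc_iff[of "\<lambda>k. 1 / (real k + 1/2) powr x"])
qed

text \<open>
  Both \<open>\<sigma>\<^sub>p\<close> and the kernel \<open>h\<close> are series of functions with such bounds: the \<open>j\<close>-th root exceeds
  \<open>j + 1/2\<close>, and \<open>2 \<pi> (k + 1)\<close> does so for index \<open>k\<close>. Summability, continuity, exponential decay and the
  termwise Mellin transform follow for both at once.
\<close>
locale exp_dominated_series =
  fixes u :: "nat \<Rightarrow> real \<Rightarrow> complex"
  assumes cont: "\<And>k. continuous_on {0<..} (u k)"
      and bound: "\<And>k t. t > 0 \<Longrightarrow> norm (u k t) \<le> exp (- ((real k + 1/2) * t))"
begin

lemma summable_norm_term:
  assumes "t > 0"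
  shows "summable (\<lambda>k. norm (u k t))"
proof (rule summable_comparison_test')
  show "summable (\<lambda>k. exp (- ((real k + 1/2) * t)))"
    using exp_half_sums[OF assms] by (rule sums_summable)
  show "norm (norm (u k t)) \<le> exp (- ((real k + 1/2) * t))" for k
    using bound[OF assms, of k] by simp
qed

lemma norm_suminf_le:
  assumes "t > 0"
  shows "norm (\<Sum>k. u k t) \<le> exp (- t / 2) / (1 - exp (- t))"
proof -
  have "norm (\<Sum>k. u k t) \<le> (\<Sum>k. norm (u k t))"
    by (rule summable_norm[OF summable_norm_term[OF assms]])
  also have "\<dots> \<le> (\<Sum>k. exp (- ((real k + 1/2) * t)))"
    by (intro suminf_le bound assms summable_norm_term sums_summable[OF exp_half_sums[OF assms]])
  finally show ?thesis
    using exp_half_sums[OF assms] by (simp add: sums_iff)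
qed

lemma norm_suminf_le_exp:
  assumes "c > 0" "t \<ge> c"
  shows "norm (\<Sum>k. u k t) \<le> 1 / (1 - exp (- c)) * exp (- (1/2 * t))"
proof -
  have "norm (\<Sum>k. u k t) \<le> exp (- t / 2) / (1 - exp (- t))"
    using assms by (intro norm_suminf_le) linarith
  also have "\<dots> \<le> exp (- t / 2) / (1 - exp (- c))"
  proof (rule divide_left_mono)
    show "1 - exp (- c) \<le> 1 - exp (- t)" using assms by simp
    have "exp (- t) < 1" "exp (- c) < 1" using assms by simp_all
    then show "0 < (1 - exp (- t)) * (1 - exp (- c))" by simp
  qed simp
  finally show ?thesis by simp
qed

lemma continuous_on_suminf: "continuous_on {0<..} (\<lambda>t. \<Sum>k. u k t)"
proof -
  have "isCont (\<lambda>t. \<Sum>k. u k t) x" if x: "x > 0" for x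
  proof -
    have "uniform_limit {x/2<..} (\<lambda>n t. \<Sum>k<n. u k t) (\<lambda>t. \<Sum>k. u k t) sequentially"
    proof (rule Weierstrass_m_test)
      fix k t assume "t \<in> {x/2<..}"
      then have t: "t > x / 2" by simp
      then have "norm (u k t) \<le> exp (- ((real k + 1/2) * t))"
        using x by (intro bound) simp
      also have "\<dots> \<le> exp (- ((real k + 1/2) * (x / 2)))"
        using t mult_left_mono[of "x/2" t "real k + 1/2"] by simp
      finally show "norm (u k t) \<le> exp (- ((real k + 1/2) * (x / 2)))" .
    next
      show "summable (\<lambda>k. exp (- ((real k + 1/2) * (x / 2))))"
        using exp_half_sums[of "x / 2"] x by (auto simp: sums_iff)
    qed
    then have "continuous_on {x/2<..} (\<lambda>t. \<Sum>k. u k t)"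
    proof (rule uniform_limit_theorem[rotated])
      show "\<forall>\<^sub>F n in sequentially. continuous_on {x/2<..} (\<lambda>t. \<Sum>k<n. u k t)"
        by (intro always_eventually allI continuous_on_sum continuous_on_subset[OF cont]) (use x in auto)
    qed auto
    then show ?thesis
      using x by (simp add: continuous_on_eq_continuous_at)
  qed
  then show ?thesis
    by (intro continuous_at_imp_continuous_on) auto
qed

text \<open>
  The absolute Mellin integrals are bounded by \<open>\<Gamma>(Re s) / (k + 1/2)\<^bsup>Re s\<^esup>\<close>, which is summable exactly
  because \<open>Re s > 1\<close>.
\<close>
lemma Mellin_sums:
  assumes s: "Re s > 1"
  shows "(\<lambda>k. LBINT t:{0<..}. u k t * of_real t powr (s - 1)) sums
           (LBINT t:{0<..}. (\<Sum>k. u k t) * of_real t powr (s - 1))"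
proof -
  define f where "f = (\<lambda>k t. indicator {0<..} t *\<^sub>R (u k t * complex_of_real t powr (s - 1)))"
  define g where "g = (\<lambda>k t. exp (- ((real k + 1/2) * t)) * t powr (Re s - 1))"
  have g: "set_integrable lborel {0<..} (g k)" "(LBINT t:{0<..}. g k t) = Gamma (Re s) / (real k + 1/2) powr Re s" for k
    unfolding g_def using s by (intro Gamma_integral_scaled_real; simp)+
  have dom: "norm (u k t * complex_of_real t powr (s - 1)) \<le> g k t" if "t > 0" for k t
    using mult_right_mono[OF bound[OF that], of "t powr (Re s - 1)" k] that
    by (simp add: norm_mult norm_of_real_powr g_def)
  have int: "set_integrable lborel {0<..} (\<lambda>t. u k t * complex_of_real t powr (s - 1))" for k
    by (rule set_integrable_dominated[OF _ _ g(1)[of k]])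
       (auto intro!: continuous_on_mult cont continuous_on_of_real_powr dom)
  have f_int: "integrable lborel (f k)" for k
    using int[of k] unfolding set_integrable_def f_def .
  have "norm (LBINT t. norm (f k t)) \<le> Gamma (Re s) * (1 / (real k + 1/2) powr Re s)" for k
  proof -
    have "(LBINT t. norm (f k t)) = (LBINT t:{0<..}. norm (u k t * complex_of_real t powr (s - 1)))"
      unfolding set_lebesgue_integral_def f_def by simp
    also have "\<dots> \<le> (LBINT t:{0<..}. g k t)"
      by (intro set_integral_mono set_integrable_norm int g dom) simp
    finally have "(LBINT t. norm (f k t)) \<le> Gamma (Re s) * (1 / (real k + 1/2) powr Re s)"
      by (simp add: g)
    moreover have "(LBINT t. norm (f k t)) \<ge> 0"
      by (rule integral_nonneg_AE) simp
    ultimately show ?thesis by simp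
  qed
  then have norm_summ: "summable (\<lambda>k. LBINT t. norm (f k t))"
    by (intro summable_comparison_test'[OF summable_mult[OF summable_half_shift_powr[OF s]]]) blast
  have "summable (\<lambda>k. norm (f k t))" for t
  proof (cases "t > 0")
    case True
    then show ?thesis
      using summable_mult2[OF summable_norm_term[OF True], of "norm (complex_of_real t powr (s - 1))"]
      by (simp add: f_def norm_mult)
  qed (simp add: f_def)
  then have AE: "AE t in lborel. summable (\<lambda>k. norm (f k t))" by simp
  have "(\<Sum>k. f k t) = indicator {0<..} t *\<^sub>R ((\<Sum>k. u k t) * of_real t powr (s - 1))" for t
  proof (cases "t > 0")
    case True
    then have "summable (\<lambda>k. u k t)"
      by (rule summable_norm_cancel[OF summable_norm_term])
    then show ?thesis
      using True by (simp add: f_def suminf_mult2)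
  qed (simp add: f_def)
  then show ?thesis
    using sums_integral[OF f_int AE norm_summ]
    unfolding set_lebesgue_integral_def f_def by simp
qed

end

section \<open>The two Dirichlet series as Mellin transforms\<close>

lemma koshliakov_sigma_series: "p > 0 \<Longrightarrow> exp_dominated_series
    (\<lambda>j t. of_real (koshliakov_weight p j) * exp (- (of_real (koshliakov_root p j) * of_real t)))"
proof
  show "continuous_on {0<..} (\<lambda>t. complex_of_real (koshliakov_weight p j) * exp (- (of_real (koshliakov_root p j) * of_real t)))" for j
    by (intro continuous_intros)
  fix j :: nat and t :: real assume p: "p > 0" and t: "t > 0"
  note w = koshliakov_weight_bounds[OF p, of j]
  have "(real j + 1/2) * t \<le> koshliakov_root p j * t"
    using koshliakov_root_enumeration(3)[OF p, of j] t by (intro mult_right_mono) auto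
  then have "exp (- (koshliakov_root p j * t)) \<le> exp (- ((real j + 1/2) * t))"
    by simp
  then have "koshliakov_weight p j * exp (- (koshliakov_root p j * t)) \<le> 1 * exp (- ((real j + 1/2) * t))"
    using w by (intro mult_mono) auto
  then show "norm (of_real (koshliakov_weight p j) * exp (- (complex_of_real (koshliakov_root p j) * of_real t)))
      \<le> exp (- ((real j + 1/2) * t))"
    using w by (simp add: norm_mult)
qed

lemma koshliakov_zeta_series_Mellin:
  assumes p: "p > 0" and s: "Re s > 1"
  shows "koshliakov_zeta_series p s =
           rGamma s * (LBINT t:{0<..}. koshliakov_sigma p (of_real t) * of_real t powr (s - 1))"
proof -
  interpret exp_dominated_series "\<lambda>j t. of_real (koshliakov_weight p j) * exp (- (of_real (koshliakov_root p j) * of_real t))"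
    by (rule koshliakov_sigma_series[OF p])
  have term_eq: "(LBINT t:{0<..}. of_real (koshliakov_weight p j) * exp (- (of_real (koshliakov_root p j) * of_real t)) * of_real t powr (s - 1))
      = Gamma s * (of_real (koshliakov_weight p j) * (1 / of_real (koshliakov_root p j) powr s))" for j
  proof -
    have r: "koshliakov_root p j > 0"
      using koshliakov_root_enumeration(3)[OF p, of j] by auto
    have "(LBINT t:{0<..}. of_real (koshliakov_weight p j) * exp (- (of_real (koshliakov_root p j) * of_real t)) * of_real t powr (s - 1))
        = (LBINT t:{0<..}. of_real (koshliakov_weight p j) * (of_real (exp (- (koshliakov_root p j * t))) * of_real t powr (s - 1)))"
      by (intro set_lebesgue_integral_cong) (simp_all add: mult.assoc flip: exp_of_real)
    also have "\<dots> = of_real (koshliakov_weight p j) * (Gamma s / of_real (koshliakov_root p j) powr s)"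
      using Gamma_integral_scaled(2)[of s "koshliakov_root p j"] s r by simp
    finally show ?thesis by simp
  qed
  have "s \<notin> \<int>\<^sub>\<le>\<^sub>0"
    using s by (auto elim!: nonpos_Ints_cases)
  then have "rGamma s * Gamma s = 1"
    by (simp add: rGamma_inverse_Gamma Gamma_eq_zero_iff)
  moreover have "(\<lambda>j. rGamma s * (Gamma s * (of_real (koshliakov_weight p j) * (1 / of_real (koshliakov_root p j) powr s)))) sums
      (rGamma s * (LBINT t:{0<..}. koshliakov_sigma p (of_real t) * of_real t powr (s - 1)))"
    using sums_mult[OF Mellin_sums[OF s], of "rGamma s"] unfolding term_eq koshliakov_sigma_def .
  ultimately show ?thesis
    unfolding koshliakov_zeta_series_def by (simp add: sums_iff flip: mult.assoc)
qed

definition koshliakov_ratio :: "real \<Rightarrow> real \<Rightarrow> real" where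
  "koshliakov_ratio p y = (p - y) / (p + y) * exp (- (2 * pi * y))"

definition koshliakov_kernel :: "real \<Rightarrow> real \<Rightarrow> real" where
  "koshliakov_kernel p y = koshliakov_ratio p y / (1 - koshliakov_ratio p y)"

lemma abs_koshliakov_ratio_le:
  assumes "p > 0" "y \<ge> 0"
  shows "\<bar>koshliakov_ratio p y\<bar> \<le> exp (- (2 * pi * y))"
proof -
  have "\<bar>(p - y) / (p + y)\<bar> \<le> 1"
    using assms by (auto simp: abs_le_iff field_simps)
  then show ?thesis
    using mult_left_le_one_le[of "exp (- (2 * pi * y))" "\<bar>(p - y) / (p + y)\<bar>"]
    unfolding koshliakov_ratio_def abs_mult by simp
qed

lemma koshliakov_ratio_less_1:
  assumes "p > 0" "y > 0"
  shows "\<bar>koshliakov_ratio p y\<bar> < 1"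
proof -
  have "\<bar>koshliakov_ratio p y\<bar> \<le> exp (- (2 * pi * y))"
    using assms by (intro abs_koshliakov_ratio_le) auto
  also have "\<dots> < 1" using assms by simp
  finally show ?thesis .
qed

lemma koshliakov_kernel_series:
  assumes p: "p > 0"
  shows "exp_dominated_series (\<lambda>k t. of_real (koshliakov_ratio p t ^ Suc k))"
proof
  show "continuous_on {0<..} (\<lambda>t. complex_of_real (koshliakov_ratio p t ^ Suc k))" for k
    unfolding koshliakov_ratio_def using p by (intro continuous_intros) auto
  fix k :: nat and t :: real assume t: "t > 0"
  have "\<bar>koshliakov_ratio p t\<bar> ^ Suc k \<le> exp (- (2 * pi * t)) ^ Suc k"
    using p t by (intro power_mono abs_koshliakov_ratio_le) auto
  also have "\<dots> = exp (- (real (Suc k) * (2 * pi * t)))"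
    using exp_of_nat_mult[of "Suc k" "- (2 * pi * t)"] by simp
  also have "\<dots> \<le> exp (- ((real k + 1/2) * t))"
  proof -
    have "t * 1 \<le> t * (2 * pi)" using t pi_gt3 by (intro mult_left_mono) auto
    then have "(real k + 1/2) * t \<le> real (Suc k) * (2 * pi * t)"
      using t by (intro mult_mono) (auto simp: mult_ac)
    then show ?thesis by simp
  qed
  finally show "norm (complex_of_real (koshliakov_ratio p t ^ Suc k)) \<le> exp (- ((real k + 1/2) * t))"
    by (simp add: norm_power norm_mult abs_mult power_abs)
qed

lemma koshliakov_kernel_suminf:
  assumes "p > 0" "y > 0"
  shows "(\<Sum>k. complex_of_real (koshliakov_ratio p y ^ Suc k)) = of_real (koshliakov_kernel p y)"
proof -
  have "(\<lambda>k. koshliakov_ratio p y * koshliakov_ratio p y ^ k) sums (koshliakov_ratio p y * (1 / (1 - koshliakov_ratio p y)))"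
    using koshliakov_ratio_less_1[OF assms] by (intro sums_mult geometric_sums) simp
  then have "(\<lambda>k. complex_of_real (koshliakov_ratio p y ^ Suc k)) sums of_real (koshliakov_kernel p y)"
    unfolding sums_of_real_iff by (simp add: koshliakov_kernel_def)
  then show ?thesis by (simp add: sums_iff)
qed

text \<open>
  The substitution \<open>x = 2 \<pi> k y\<close> removes \<open>k\<close> from the fraction and turns the integrand of
  \<open>(s, 2\<pi>pk)\<^sub>k\<close> into the \<open>k\<close>-th power of one function of \<open>y\<close>.
\<close>
lemma koshliakov_symbol_Mellin:
  assumes p: "p > 0" and s: "Re s > 0" and k: "k > 0"
  shows "koshliakov_symbol s (2 * pi * p) k / of_nat k powr s =
     (2 * of_real pi) powr s * (rGamma s * (LBINT y:{0<..}. of_real (koshliakov_ratio p y ^ k) * of_real y powr (s - 1)))"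
proof -
  define b where "b = 2 * pi * real k"
  have b: "b > 0" using k by (simp add: b_def)
  define G where "G = (\<lambda>x. indicator {0<..} x *\<^sub>R
      (of_real (exp (- x) * ((real k * (2 * pi * p) - x) / (real k * (2 * pi * p) + x)) ^ k) * complex_of_real x powr (s - 1)))"
  define H where "H = (\<lambda>y. indicator {0<..} y *\<^sub>R (of_real (koshliakov_ratio p y ^ k) * complex_of_real y powr (s - 1)))"
  have scale: "G (0 + b * y) = of_real b powr (s - 1) * H y" for y
  proof (cases "y > 0")
    case True
    have "(real k * (2 * pi * p) - b * y) / (real k * (2 * pi * p) + b * y) = (b * (p - y)) / (b * (p + y))"
      by (simp add: b_def algebra_simps)
    also have "\<dots> = (p - y) / (p + y)" using b by simp
    finally have "exp (- (b * y)) * ((real k * (2 * pi * p) - b * y) / (real k * (2 * pi * p) + b * y)) ^ k = koshliakov_ratio p y ^ k"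
      using exp_of_nat_mult[of k "- (2 * pi * y)"]
      unfolding koshliakov_ratio_def power_mult_distrib b_def by (simp add: mult_ac)
    moreover have "complex_of_real (b * y) powr (s - 1) = of_real b powr (s - 1) * of_real y powr (s - 1)"
      using b True by (simp add: powr_times_real)
    moreover have "b * y > 0" using b True by simp
    ultimately show ?thesis
      using True unfolding G_def H_def add_0 by (simp only: indicator_simps greaterThan_iff scaleR_one mult_ac)
  next
    case False
    then have "\<not> b * y > 0" using b by (simp add: zero_less_mult_iff)
    then show ?thesis using False by (simp add: G_def H_def)
  qed
  have "koshliakov_symbol s (2 * pi * p) k = rGamma s * (LBINT x. G x)"
    unfolding koshliakov_symbol_def set_lebesgue_integral_def G_def
    by (simp add: rGamma_inverse_Gamma divide_inverse)
  also have "(LBINT x. G x) = of_real b * (of_real b powr (s - 1) * (LBINT y. H y))"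
    using lborel_integral_real_affine[of b G 0] b unfolding scale by (simp add: scaleR_conv_of_real)
  also have "\<dots> = of_real b powr s * (LBINT y. H y)"
    using b by (simp add: powr_diff)
  also have "complex_of_real b powr s = (2 * of_real pi) powr s * of_nat k powr s"
    using powr_times_real[of "2 * of_real pi" "of_nat k" s] by (simp add: b_def)
  finally show ?thesis
    using k unfolding H_def set_lebesgue_integral_def by simp
qed

lemma koshliakov_eta_series_Mellin:
  assumes p: "p > 0" and s: "Re s > 1"
  shows "koshliakov_eta_series p s = (2 * of_real pi) powr s *
           (rGamma s * (LBINT y:{0<..}. of_real (koshliakov_kernel p y) * of_real y powr (s - 1)))"
proof -
  interpret exp_dominated_series "\<lambda>k t. of_real (koshliakov_ratio p t ^ Suc k)"
    by (rule koshliakov_kernel_series[OF p])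
  have "(LBINT y:{0<..}. (\<Sum>k. of_real (koshliakov_ratio p y ^ Suc k)) * of_real y powr (s - 1)) =
      (LBINT y:{0<..}. of_real (koshliakov_kernel p y) * complex_of_real y powr (s - 1))"
    using koshliakov_kernel_suminf[OF p] by (intro set_lebesgue_integral_cong) auto
  then have "(\<lambda>k. LBINT y:{0<..}. of_real (koshliakov_ratio p y ^ Suc k) * complex_of_real y powr (s - 1)) sums
      (LBINT y:{0<..}. of_real (koshliakov_kernel p y) * of_real y powr (s - 1))"
    using Mellin_sums[OF s] by simp
  then have "(\<lambda>k. (2 * of_real pi) powr s * (rGamma s * (LBINT y:{0<..}. of_real (koshliakov_ratio p y ^ Suc k) * complex_of_real y powr (s - 1)))) sums
      ((2 * of_real pi) powr s * (rGamma s * (LBINT y:{0<..}. of_real (koshliakov_kernel p y) * of_real y powr (s - 1))))"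
    by (intro sums_mult)
  then show ?thesis
    unfolding koshliakov_eta_series_def
    using koshliakov_symbol_Mellin[OF p, of s "Suc k" for k] s by (simp add: sums_iff)
qed

section \<open>The quotient whose residues are the weights\<close>

definition koshliakov_den :: "real \<Rightarrow> complex \<Rightarrow> complex" where
  "koshliakov_den p z = of_real p * sin (of_real pi * z) + z * cos (of_real pi * z)"

definition koshliakov_num :: "real \<Rightarrow> complex \<Rightarrow> complex" where
  "koshliakov_num p z = of_real p * cos (of_real pi * z) - z * sin (of_real pi * z)"

text \<open>
  Write \<open>f\<close> for the denominator and \<open>g\<close> for the numerator, and call the right-hand sides \<open>A\<close> and \<open>B\<close>. The quotient \<open>g / f\<close> is \<open>\<i> (A + B) / (A - B)\<close>, and \<open>A\<close> and \<open>B\<close> are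
  easy to compare because each is a linear factor times an exponential.
\<close>
lemma koshliakov_num_plus_den:
  "koshliakov_num p z + \<i> * koshliakov_den p z = (of_real p + \<i> * z) * exp (\<i> * of_real pi * z)"
  "koshliakov_num p z - \<i> * koshliakov_den p z = (of_real p - \<i> * z) * exp (- (\<i> * of_real pi * z))"
proof -
  have e: "exp (\<i> * of_real pi * z) = cos (of_real pi * z) + \<i> * sin (of_real pi * z)"
    using exp_Euler[of "of_real pi * z"] by (simp add: mult.assoc)
  have e': "exp (- (\<i> * of_real pi * z)) = cos (of_real pi * z) - \<i> * sin (of_real pi * z)"
    using exp_minus_Euler[of "of_real pi * z"] by (simp add: mult.assoc)
  show "koshliakov_num p z + \<i> * koshliakov_den p z = (of_real p + \<i> * z) * exp (\<i> * of_real pi * z)"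
    unfolding e koshliakov_num_def koshliakov_den_def by (simp add: algebra_simps)
  show "koshliakov_num p z - \<i> * koshliakov_den p z = (of_real p - \<i> * z) * exp (- (\<i> * of_real pi * z))"
    unfolding e' koshliakov_num_def koshliakov_den_def by (simp add: algebra_simps)
qed

text \<open>
  For \<open>Im z > 0\<close> one has \<open>\<bar>p + \<i>z\<bar> \<le> \<bar>p - \<i>z\<bar>\<close>, hence \<open>\<bar>A\<bar> \<le> e\<^bsup>-2\<pi> Im z\<^esup> \<bar>B\<bar>\<close>. So \<open>A - B\<close> does not vanish, and
  the quotient differs from its limit \<open>-\<i>\<close> by \<open>A\<close> divided by the denominator.
\<close>
lemma koshliakov_quotient_upper_half_plane:
  assumes p: "p > 0" and z: "Im z > 0"
  shows "koshliakov_den p z \<noteq> 0"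
    and "norm (koshliakov_num p z / koshliakov_den p z + \<i>) \<le>
           2 * exp (- (2 * pi * Im z)) / (1 - exp (- (2 * pi * Im z)))"
proof -
  define A where "A = koshliakov_num p z + \<i> * koshliakov_den p z"
  define B where "B = koshliakov_num p z - \<i> * koshliakov_den p z"
  define e where "e = exp (- (2 * pi * Im z))"
  have e: "0 < e" "e < 1" using z by (simp_all add: e_def)
  have "norm (of_real p + \<i> * z) \<le> norm (of_real p - \<i> * z)"
  proof -
    have "(p - Im z)\<^sup>2 + (Re z)\<^sup>2 \<le> (p + Im z)\<^sup>2 + (Re z)\<^sup>2"
      using p z by (simp add: power2_eq_square algebra_simps)
    then show ?thesis by (simp add: cmod_def)
  qed
  then have "norm A \<le> norm (of_real p - \<i> * z) * exp (- (pi * Im z))"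
    unfolding A_def koshliakov_num_plus_den by (simp add: norm_mult)
  moreover have nB: "norm B = norm (of_real p - \<i> * z) * exp (pi * Im z)"
    unfolding B_def koshliakov_num_plus_den by (simp add: norm_mult)
  moreover have "exp (- (pi * Im z)) = exp (pi * Im z) * e"
    unfolding e_def by (simp add: algebra_simps flip: exp_add)
  ultimately have AB: "norm A \<le> norm B * e" by (simp add: mult.assoc)
  have "of_real p - \<i> * z \<noteq> 0"
  proof
    assume "of_real p - \<i> * z = 0"
    then have "Re (of_real p - \<i> * z) = 0" by simp
    then show False using p z by simp
  qed
  then have B: "norm B > 0" unfolding nB by simp
  have "B = A - 2 * \<i> * koshliakov_den p z" by (simp add: A_def B_def)
  then have "norm B \<le> norm A + 2 * norm (koshliakov_den p z)"
    using norm_triangle_ineq4[of A "2 * \<i> * koshliakov_den p z"] by (simp add: norm_mult)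
  then have den: "norm B * (1 - e) \<le> 2 * norm (koshliakov_den p z)"
    using AB by (simp add: algebra_simps)
  moreover have "norm B * (1 - e) > 0" using B e by simp
  ultimately show nz: "koshliakov_den p z \<noteq> 0" by auto
  then have "koshliakov_num p z / koshliakov_den p z + \<i> = A / koshliakov_den p z"
    by (simp add: A_def field_simps)
  then have "norm (koshliakov_num p z / koshliakov_den p z + \<i>) = norm A / norm (koshliakov_den p z)"
    by (simp add: norm_divide)
  also have "\<dots> \<le> (norm B * e) / (norm B * (1 - e) / 2)"
    using AB den B e by (intro frac_le) auto
  also have "\<dots> = 2 * e / (1 - e)"
    using B mult_divide_mult_cancel_left[of "norm B" e "(1 - e) / 2"] by simp
  finally show "norm (koshliakov_num p z / koshliakov_den p z + \<i>) \<le>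
           2 * exp (- (2 * pi * Im z)) / (1 - exp (- (2 * pi * Im z)))"
    by (simp add: e_def)
qed

lemma koshliakov_den_cnj: "koshliakov_den p (cnj z) = cnj (koshliakov_den p z)"
  by (simp add: koshliakov_den_def cnj_sin cnj_cos)

lemma koshliakov_num_cnj: "koshliakov_num p (cnj z) = cnj (koshliakov_num p z)"
  by (simp add: koshliakov_num_def cnj_sin cnj_cos)

lemma koshliakov_quotient_lower_half_plane:
  assumes p: "p > 0" and z: "Im z < 0"
  shows "norm (koshliakov_num p z / koshliakov_den p z - \<i>) \<le>
           2 * exp (2 * pi * Im z) / (1 - exp (2 * pi * Im z))"
proof -
  have "koshliakov_num p z / koshliakov_den p z - \<i> =
      cnj (koshliakov_num p (cnj z) / koshliakov_den p (cnj z) + \<i>)"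
    by (simp add: koshliakov_den_cnj koshliakov_num_cnj)
  then show ?thesis
    using koshliakov_quotient_upper_half_plane(2)[OF p, of "cnj z"] z by (simp only: complex_mod_cnj) simp
qed

lemma koshliakov_den_eq_0_imp_real:
  assumes p: "p > 0" and z: "koshliakov_den p z = 0"
  shows "z = of_real (Re z)"
proof -
  have "\<not> Im z > 0" using koshliakov_quotient_upper_half_plane(1)[OF p, of z] z by blast
  moreover have "\<not> Im (cnj z) > 0"
    using koshliakov_quotient_upper_half_plane(1)[OF p, of "cnj z"] z by (auto simp: koshliakov_den_cnj)
  ultimately show ?thesis by (simp add: complex_eq_iff)
qed

lemma koshliakov_den_of_real:
  "koshliakov_den p (of_real x) = of_real (p * sin (pi * x) + x * cos (pi * x))"
  by (simp add: koshliakov_den_def sin_of_real cos_of_real flip: of_real_mult)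

lemma koshliakov_den_minus: "koshliakov_den p (- z) = - koshliakov_den p z"
  by (simp add: koshliakov_den_def)

lemma koshliakov_den_eq_0D:
  assumes p: "p > 0" and z: "koshliakov_den p z = 0" "Re z > -1/2"
  shows "z = 0 \<or> z \<in> range (\<lambda>j. of_real (koshliakov_root p j))"
proof -
  define x where "x = Re z"
  have zx: "z = of_real x"
    unfolding x_def by (rule koshliakov_den_eq_0_imp_real[OF p z(1)])
  have "\<not> x < 0"
  proof
    assume "x < 0"
    moreover have "koshliakov_den p (of_real (- x)) = 0"
      using z(1) zx koshliakov_den_minus[of p z] by simp
    ultimately have "- x \<in> koshliakov_roots p"
      unfolding koshliakov_den_of_real koshliakov_roots_def of_real_eq_0_iff by simp
    then obtain j :: nat where "- x \<in> {real j + 1/2<..<real j + 1}"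
      using koshliakov_roots_in_half_interval[OF p] by blast
    then show False using z(2) by (simp add: x_def)
  qed
  moreover have "x \<in> range (koshliakov_root p)" if "x > 0"
    using that z(1) unfolding zx koshliakov_den_of_real koshliakov_root_enumeration(2)[OF p] koshliakov_roots_def of_real_eq_0_iff
    by simp
  ultimately show ?thesis
    using zx by (cases "x = 0") auto
qed

lemma koshliakov_root_eq:
  assumes "p > 0"
  shows "p * sin (pi * koshliakov_root p j) + koshliakov_root p j * cos (pi * koshliakov_root p j) = 0"
    and "koshliakov_root p j > 0"
proof -
  have "koshliakov_root p j \<in> koshliakov_roots p"
    using koshliakov_root_enumeration(2)[OF assms] by blast
  then show "p * sin (pi * koshliakov_root p j) + koshliakov_root p j * cos (pi * koshliakov_root p j) = 0"
    "koshliakov_root p j > 0"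
    by (auto simp: koshliakov_roots_def)
qed

text \<open>
  Removing the simple zero of the denominator at \<open>0\<close> makes it possible to run the contour through \<open>0\<close>
  without an indentation.
\<close>
definition koshliakov_den_quotient :: "real \<Rightarrow> complex \<Rightarrow> complex" where
  "koshliakov_den_quotient p z = (if z = 0 then of_real (p * pi + 1) else koshliakov_den p z / z)"

lemma koshliakov_den_deriv:
  "(koshliakov_den p has_field_derivative
     (of_real (p * pi + 1) * cos (of_real pi * z) - of_real pi * z * sin (of_real pi * z))) (at z)"
  unfolding koshliakov_den_def[abs_def]
  by (auto intro!: derivative_eq_intros simp: algebra_simps)

lemma koshliakov_den_holomorphic: "koshliakov_den p holomorphic_on A"
  unfolding koshliakov_den_def[abs_def] by (intro holomorphic_intros)

lemma koshliakov_num_holomorphic: "koshliakov_num p holomorphic_on A"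
  unfolding koshliakov_num_def[abs_def] by (intro holomorphic_intros)

lemma holomorphic_divide_id:
  assumes f: "f holomorphic_on UNIV" "f 0 = 0" "(f has_field_derivative d) (at 0)"
  shows "(\<lambda>z. if z = 0 then d else f z / z) holomorphic_on UNIV"
  by (rule pole_theorem_open_0[OF f(1) open_UNIV, of 0])
     (auto simp: f(2) DERIV_imp_deriv[OF f(3)])

lemma koshliakov_den_quotient_holomorphic: "koshliakov_den_quotient p holomorphic_on A"
proof -
  have "(koshliakov_den p has_field_derivative of_real (p * pi + 1)) (at 0)"
    using koshliakov_den_deriv[of p 0] by simp
  then have "koshliakov_den_quotient p holomorphic_on UNIV"
    unfolding koshliakov_den_quotient_def[abs_def]
    by (intro holomorphic_divide_id koshliakov_den_holomorphic) (simp add: koshliakov_den_def)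
  then show ?thesis by (rule holomorphic_on_subset) simp
qed

lemma koshliakov_den_quotient_eq_0D:
  assumes p: "p > 0" and z: "koshliakov_den_quotient p z = 0" "Re z > -1/2"
  shows "z \<in> range (\<lambda>j. of_real (koshliakov_root p j))"
proof -
  have "p * pi + 1 > 0" using p by (simp add: add_pos_pos)
  then have "complex_of_real (p * pi + 1) \<noteq> 0" by (simp only: of_real_eq_0_iff)
  then have "z \<noteq> 0" "koshliakov_den p z = 0"
    using z(1) by (auto simp: koshliakov_den_quotient_def split: if_splits)
  then show ?thesis using koshliakov_den_eq_0D[OF p _ z(2)] by blast
qed

text \<open>
  At a root \<open>l\<close> we have \<open>sin (\<pi> l) = - l cos (\<pi> l) / p\<close>. Substituting this leaves a factor
  \<open>cos (\<pi> l)\<close> in the numerator and in the derivative of the denominator; it cancels, and what remains is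
  the weight.
\<close>
lemma koshliakov_weight_residue:
  fixes p :: real and j :: nat
  assumes p: "p > 0"
  defines "l \<equiv> koshliakov_root p j"
  obtains d where "d \<noteq> 0" "koshliakov_num p (of_real l) \<noteq> 0"
    "(koshliakov_den p has_field_derivative d) (at (of_real l))"
    "of_real pi * koshliakov_num p (of_real l) / d = of_real (koshliakov_weight p j)"
proof -
  define C where "C = cos (pi * l)"
  define S where "S = sin (pi * l)"
  have eq: "p * S + l * C = 0" and l: "l > 0"
    using koshliakov_root_eq[OF p, of j] by (simp_all add: l_def C_def S_def)
  have S: "S = - l * C / p"
    using eq p by (simp add: field_simps)
  have C: "C \<noteq> 0"
  proof
    assume "C = 0"
    then have "S = 0" using S by simp
    then show False using \<open>C = 0\<close> sin_cos_squared_add[of "pi * l"] by (simp add: C_def S_def)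
  qed
  have sc: "sin (complex_of_real pi * of_real l) = of_real S" "cos (complex_of_real pi * of_real l) = of_real C"
    by (simp_all add: C_def S_def sin_of_real cos_of_real flip: of_real_mult)
  have num: "koshliakov_num p (of_real l) = of_real (C * (p\<^sup>2 + l\<^sup>2) / p)"
  proof -
    have "koshliakov_num p (of_real l) = of_real (p * C - l * S)"
      by (simp add: koshliakov_num_def sc)
    also have "p * C - l * S = C * (p\<^sup>2 + l\<^sup>2) / p"
      using p by (simp add: S field_simps power2_eq_square)
    finally show ?thesis .
  qed
  define D where "D = C * (pi / p) * (p * (p + 1 / pi) + l\<^sup>2)"
  have pos: "p * (p + 1 / pi) + l\<^sup>2 > 0" "p\<^sup>2 + l\<^sup>2 > 0"
    using p pi_gt_zero by (intro add_pos_nonneg mult_pos_pos add_pos_pos; simp)+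
  have deriv: "(koshliakov_den p has_field_derivative of_real D) (at (of_real l))"
  proof -
    have "of_real (p * pi + 1) * cos (of_real pi * of_real l) - of_real pi * of_real l * sin (of_real pi * of_real l)
        = complex_of_real ((p * pi + 1) * C - pi * l * S)"
      by (simp add: sc)
    also have "(p * pi + 1) * C - pi * l * S = D"
      using p by (simp add: S D_def field_simps power2_eq_square)
    finally show ?thesis using koshliakov_den_deriv[of p "of_real l"] by simp
  qed
  show thesis
  proof (rule that[of "of_real D"])
    show "complex_of_real D \<noteq> 0"
      using C p pos(1) unfolding of_real_eq_0_iff D_def by simp
    show "koshliakov_num p (of_real l) \<noteq> 0"
      using C p pos(2) unfolding num of_real_eq_0_iff by simp
    have "pi * (C * (p\<^sup>2 + l\<^sup>2) / p) / D = (p\<^sup>2 + l\<^sup>2) / (p * (p + 1 / pi) + l\<^sup>2)"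
      using C p by (simp add: D_def)
    then show "of_real pi * koshliakov_num p (of_real l) / of_real D = of_real (koshliakov_weight p j)"
      unfolding num koshliakov_weight_def l_def[symmetric] by (simp flip: of_real_mult of_real_divide)
  qed (fact deriv)
qed

lemma koshliakov_residue:
  assumes p: "p > 0" and E: "E holomorphic_on UNIV" "E (of_real (koshliakov_root p j)) \<noteq> 0"
  shows "residue (\<lambda>z. koshliakov_num p z * E z / koshliakov_den_quotient p z) (of_real (koshliakov_root p j)) =
     of_real (koshliakov_weight p j / pi) * (of_real (koshliakov_root p j) * E (of_real (koshliakov_root p j)))"
proof -
  define l where "l = complex_of_real (koshliakov_root p j)"
  have l: "l \<noteq> 0"
    using koshliakov_root_eq(2)[OF p, of j] by (simp add: l_def)
  have den_l: "koshliakov_den p l = 0"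
    using koshliakov_root_eq(1)[OF p, of j] unfolding l_def koshliakov_den_of_real by simp
  obtain d where d: "d \<noteq> 0" "koshliakov_num p l \<noteq> 0" "(koshliakov_den p has_field_derivative d) (at l)"
    "of_real pi * koshliakov_num p l / d = of_real (koshliakov_weight p j)"
    using koshliakov_weight_residue[OF p, of j] unfolding l_def by blast
  have phi_deriv: "(koshliakov_den_quotient p has_field_derivative d / l) (at l)"
  proof -
    have "((\<lambda>z. koshliakov_den p z / z) has_field_derivative d / l) (at l)"
      using l by (auto intro!: derivative_eq_intros d(3) simp: den_l field_simps)
    then show ?thesis
    proof (rule DERIV_cong_ev[THEN iffD1, rotated 3, OF _])
      show "\<forall>\<^sub>F z in nhds l. koshliakov_den p z / z = koshliakov_den_quotient p z"
        using t1_space_nhds[OF l] by eventually_elim (simp add: koshliakov_den_quotient_def)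
    qed auto
  qed
  have "residue (\<lambda>z. koshliakov_num p z * E z / koshliakov_den_quotient p z) l = koshliakov_num p l * E l / (d / l)"
  proof (rule residue_simple_pole_deriv)
    show "(\<lambda>z. koshliakov_num p z * E z) holomorphic_on UNIV"
      by (intro holomorphic_intros koshliakov_num_holomorphic E)
    show "koshliakov_den_quotient p l = 0" using l den_l by (simp add: koshliakov_den_quotient_def)
    show "koshliakov_num p l * E l \<noteq> 0" using d(2) E(2) by (simp add: l_def)
  qed (use d l phi_deriv koshliakov_den_quotient_holomorphic in auto)
  also have "\<dots> = (of_real pi * koshliakov_num p l / d) / of_real pi * (l * E l)"
    using d l by (simp add: field_simps)
  finally show ?thesis
    unfolding d(4) by (simp add: l_def)
qed

text \<open>
  At \<open>Re z = N\<close> the sine and cosine are, up to a common sign, \<open>\<i> sinh (\<pi> y)\<close> and \<open>cosh (\<pi> y)\<close>, so the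
  denominator has real part \<open>\<plusminus> N cosh (\<pi> y)\<close>.
  The numerator is at most a multiple of \<open>N cosh (\<pi> y)\<close> for \<open>\<bar>y\<bar> \<le> N\<close>.
\<close>
lemma koshliakov_quotient_vertical_line:
  assumes p: "p > 0" and N: "N > 0" and z: "Re z = real N" "\<bar>Im z\<bar> \<le> real N"
  shows "koshliakov_den p z \<noteq> 0" "norm (koshliakov_num p z / koshliakov_den p z) \<le> p + 2"
proof -
  define y where "y = Im z"
  have pz: "of_real pi * z = \<i> * of_real (pi * y) + of_nat N * of_real pi"
    using z by (simp add: complex_eq_iff y_def)
  have cosh: "cos (\<i> * complex_of_real x) = of_real (cosh x)" and
       sinh: "sin (\<i> * complex_of_real x) = \<i> * of_real (sinh x)" for x
    using cosh_conv_cos[of "complex_of_real x"] sinh_conv_sin[of "complex_of_real x"]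
    by (simp_all add: cosh_field_def sinh_field_def complex_eq_iff flip: exp_of_real of_real_minus)
  have sn: "sin (of_nat N * complex_of_real pi) = 0" and cn: "cos (of_nat N * complex_of_real pi) = (-1) ^ N"
    using sin_of_real[of "real N * pi"] cos_of_real[of "real N * pi"] by (simp_all flip: of_real_mult)
  have s: "sin (of_real pi * z) = (-1) ^ N * (\<i> * of_real (sinh (pi * y)))"
    and c: "cos (of_real pi * z) = (-1) ^ N * of_real (cosh (pi * y))"
    unfolding pz sin_add cos_add sn cn cosh sinh by simp_all
  have den: "koshliakov_den p z = (-1) ^ N * (of_real p * (\<i> * of_real (sinh (pi * y))) + z * of_real (cosh (pi * y)))"
    unfolding koshliakov_den_def s c by (simp add: algebra_simps)
  have num: "koshliakov_num p z = (-1) ^ N * (of_real p * of_real (cosh (pi * y)) - z * (\<i> * of_real (sinh (pi * y))))"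
    unfolding koshliakov_num_def s c by (simp add: algebra_simps)
  have ch: "cosh (pi * y) > 0" by (rule cosh_real_pos)
  have sh: "\<bar>sinh (pi * y)\<bar> \<le> cosh (pi * y)"
    by (simp add: sinh_field_def cosh_field_def abs_le_iff)
  have "real N * cosh (pi * y) = Re (of_real p * (\<i> * of_real (sinh (pi * y))) + z * of_real (cosh (pi * y)))"
    using z by simp
  also have "\<dots> \<le> norm (koshliakov_den p z)"
    unfolding den norm_mult norm_power norm_minus_cancel norm_one power_one mult_1
    by (rule complex_Re_le_cmod)
  finally have den_ge: "real N * cosh (pi * y) \<le> norm (koshliakov_den p z)" .
  moreover have pos: "real N * cosh (pi * y) > 0" using N ch by simp
  ultimately show "koshliakov_den p z \<noteq> 0" by auto
  have "norm z \<le> 2 * real N"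
    using cmod_le[of z] z by simp
  have "norm (koshliakov_num p z) = norm (of_real p * of_real (cosh (pi * y)) - z * (\<i> * of_real (sinh (pi * y))))"
    unfolding num by (simp add: norm_mult norm_power)
  also have "\<dots> \<le> norm (of_real p * of_real (cosh (pi * y)) :: complex) + norm (z * (\<i> * of_real (sinh (pi * y))))"
    by (rule norm_triangle_ineq4)
  also have "\<dots> = p * cosh (pi * y) + norm z * \<bar>sinh (pi * y)\<bar>"
    using p ch by (simp add: norm_mult)
  also have "\<dots> \<le> p * cosh (pi * y) + (2 * real N) * cosh (pi * y)"
    using \<open>norm z \<le> 2 * real N\<close> sh by (intro add_left_mono mult_mono) auto
  also have "\<dots> \<le> (p + 2) * (real N * cosh (pi * y))"
  proof -
    have "p * 1 \<le> p * real N" using p N by (intro mult_left_mono) auto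
    then have "(p + 2 * real N) * cosh (pi * y) \<le> (p + 2) * real N * cosh (pi * y)"
      using ch by (intro mult_right_mono) (auto simp: algebra_simps)
    then show ?thesis by (simp add: algebra_simps)
  qed
  also have "\<dots> \<le> (p + 2) * norm (koshliakov_den p z)"
    using den_ge p by (intro mult_left_mono) auto
  finally show "norm (koshliakov_num p z / koshliakov_den p z) \<le> p + 2"
    using \<open>koshliakov_den p z \<noteq> 0\<close> by (simp add: norm_divide field_simps)
qed

text \<open>
  Here \<open>A = (p - y) e\<^bsup>-\<pi>y\<^esup>\<close> and \<open>B = (p + y) e\<^bsup>\<pi>y\<^esup>\<close> are real, and \<open>A / B\<close> is the ratio that also occurs in the
  summands of \<open>\<eta>\<^sub>p\<close>. This is where the two zeta functions meet.
\<close>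
lemma koshliakov_quotient_imag_axis:
  assumes p: "p > 0" and y: "y > 0"
  shows "koshliakov_num p (\<i> * of_real y) / koshliakov_den p (\<i> * of_real y) =
     - \<i> * of_real (1 + 2 * koshliakov_kernel p y)"
proof -
  define A where "A = (p - y) * exp (- (pi * y))"
  define B where "B = (p + y) * exp (pi * y)"
  define g where "g = koshliakov_num p (\<i> * of_real y)"
  define f where "f = koshliakov_den p (\<i> * of_real y)"
  have gA: "g + \<i> * f = of_real A" and gB: "g - \<i> * f = of_real B"
    unfolding g_def f_def koshliakov_num_plus_den A_def B_def by (simp_all add: exp_of_real mult_ac flip: exp_of_real)
  have B: "B > 0" using p y by (simp add: B_def)
  have q: "koshliakov_ratio p y = A / B"
  proof -
    have "exp (- (2 * pi * y)) = exp (- (pi * y)) / exp (pi * y)"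
      by (simp flip: exp_diff)
    then show ?thesis by (simp add: koshliakov_ratio_def A_def B_def)
  qed
  have lt: "A / B < 1" using koshliakov_ratio_less_1[OF p y] q by linarith
  then have AB: "A \<noteq> B" using B by auto
  have k: "1 + 2 * koshliakov_kernel p y = (B + A) / (B - A)"
    unfolding koshliakov_kernel_def q using B AB by (simp add: field_simps)
  have g2: "2 * g = of_real (A + B)" and f2: "2 * \<i> * f = of_real (A - B)"
    using gA gB by (simp_all add: algebra_simps flip: gA gB)
  have fn: "f \<noteq> 0" using f2 AB by auto
  have "g * of_real (B - A) = - \<i> * of_real (B + A) * f"
  proof -
    have "g * of_real (B - A) * 2 = (2 * g) * - of_real (A - B)" by simp
    also have "\<dots> = of_real (A + B) * - (2 * \<i> * f)" unfolding g2 f2 ..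
    also have "\<dots> = (- \<i> * of_real (B + A) * f) * 2" by (simp add: algebra_simps)
    finally show ?thesis by (rule mult_right_cancel[THEN iffD1, rotated]) (rule zero_neq_numeral[symmetric])
  qed
  moreover have "complex_of_real (B - A) \<noteq> 0" using AB by simp
  ultimately have "g / f = - \<i> * of_real (B + A) / of_real (B - A)"
    using fn by (simp only: frac_eq_eq simp_thms)
  then have "g / f = - \<i> * of_real ((B + A) / (B - A))"
    by (simp only: of_real_divide times_divide_eq_right)
  then show ?thesis unfolding g_def f_def k .
qed

section \<open>Integrability of the kernel\<close>

text \<open>
  With \<open>v = e\<^bsup>\<pi>y\<^esup>\<close> the kernel is bounded by \<open>1 / (v\<^sup>2 - 1) = 1 / ((v - 1) (v + 1))\<close>. Near \<open>0\<close> the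
  inequality \<open>v - 1 \<ge> \<pi> y\<close> accounts for the simple pole.
\<close>
lemma koshliakov_kernel_bound:
  assumes p: "p > 0" and y: "y > 0"
  shows "y * \<bar>koshliakov_kernel p y\<bar> \<le> exp (- (pi * y))"
proof -
  define q where "q = koshliakov_ratio p y"
  define v where "v = exp (pi * y)"
  have v: "v \<ge> 1 + pi * y" "v > 1"
    using exp_ge_add_one_self[of "pi * y"] y by (simp_all add: v_def)
  have e: "exp (- (2 * pi * y)) = 1 / v\<^sup>2"
    by (simp add: v_def power2_eq_square exp_minus divide_inverse flip: exp_add)
  have q: "\<bar>q\<bar> \<le> 1 / v\<^sup>2"
    using abs_koshliakov_ratio_le[OF p, of y] y by (simp add: q_def e)
  have lt: "1 / v\<^sup>2 < 1" using v(2) by simp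
  have "1 - q > 0" using q lt by linarith
  then have "\<bar>koshliakov_kernel p y\<bar> = \<bar>q\<bar> / (1 - q)"
    by (simp add: koshliakov_kernel_def q_def[symmetric] abs_divide)
  also have "\<dots> \<le> (1 / v\<^sup>2) / (1 - 1 / v\<^sup>2)"
    using q lt by (intro frac_le) auto
  also have "\<dots> = 1 / (v\<^sup>2 - 1)"
    using v(2) by (simp add: field_simps)
  finally have h: "\<bar>koshliakov_kernel p y\<bar> \<le> 1 / (v\<^sup>2 - 1)" .
  have "y * v \<le> (pi * y) * v"
    using y v pi_gt3 by (intro mult_right_mono) auto
  also have "\<dots> \<le> (v - 1) * (v + 1)"
    using v y by (intro mult_mono) auto
  finally have "y * v \<le> v\<^sup>2 - 1"
    by (simp add: power2_eq_square algebra_simps)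
  moreover have "v\<^sup>2 - 1 > 0" using v(2) by simp
  ultimately have "y * (1 / (v\<^sup>2 - 1)) \<le> 1 / v"
    using v(2) by (simp add: field_simps)
  moreover have "y * \<bar>koshliakov_kernel p y\<bar> \<le> y * (1 / (v\<^sup>2 - 1))"
    using h y by (intro mult_left_mono) auto
  ultimately show ?thesis
    by (simp add: v_def exp_minus divide_inverse)
qed

lemma continuous_on_koshliakov_kernel:
  assumes p: "p > 0"
  shows "continuous_on {0<..} (koshliakov_kernel p)"
proof -
  have "1 - koshliakov_ratio p y \<noteq> 0" if "y \<in> {0<..}" for y
    using koshliakov_ratio_less_1[OF p, of y] that by auto
  moreover have "continuous_on {0<..} (koshliakov_ratio p)"
    unfolding koshliakov_ratio_def[abs_def] using p by (intro continuous_intros) auto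
  ultimately show ?thesis
    unfolding koshliakov_kernel_def[abs_def] by (intro continuous_intros) auto
qed

lemma koshliakov_kernel_integrable:
  fixes f :: "real \<Rightarrow> real"
  assumes p: "p > 0" and f: "continuous_on {0<..} f" "\<And>y. y > 0 \<Longrightarrow> \<bar>f y\<bar> \<le> C * y * y ^ n"
  shows "set_integrable lborel {0<..} (\<lambda>y. koshliakov_kernel p y * f y)"
proof (rule set_integrable_dominated)
  show "continuous_on {0<..} (\<lambda>y. koshliakov_kernel p y * f y)"
    by (intro continuous_intros continuous_on_koshliakov_kernel p f(1))
  have "set_integrable lborel {0<..} (\<lambda>y. exp (- (pi * y)) * y powr (real (Suc n) - 1))"
    by (rule Gamma_integral_scaled_real) auto
  then show "set_integrable lborel {0<..} (\<lambda>y. C * (exp (- (pi * y)) * y powr (real (Suc n) - 1)))"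
    by (rule set_integrable_mult_right)
  fix y :: real assume "y \<in> {0<..}"
  then have y: "y > 0" by simp
  have "0 \<le> C * y * y ^ n" using f(2)[OF y] abs_ge_zero order_trans by blast
  then have "0 \<le> C * (y * y ^ n)" by (simp only: mult.assoc)
  moreover have "y * y ^ n > 0" using y by simp
  ultimately have C: "0 \<le> C" using zero_le_mult_iff[of C "y * y ^ n"] by linarith
  have "norm (koshliakov_kernel p y * f y) \<le> \<bar>koshliakov_kernel p y\<bar> * (C * y * y ^ n)"
    using f(2)[OF y] by (simp add: abs_mult mult_left_mono)
  also have "\<dots> = C * y ^ n * (y * \<bar>koshliakov_kernel p y\<bar>)"
    by (simp only: mult_ac)
  also have "\<dots> \<le> C * y ^ n * exp (- (pi * y))"
    using y C by (intro mult_left_mono koshliakov_kernel_bound p) auto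
  also have "y ^ n = y powr (real (Suc n) - 1)"
    using y by (simp add: powr_realpow)
  finally show "norm (koshliakov_kernel p y * f y) \<le> C * (exp (- (pi * y)) * y powr (real (Suc n) - 1))"
    by (simp only: mult_ac)
qed simp

section \<open>The contour integral\<close>

lemma contour_integral_rectpath:
  assumes "continuous_on (path_image (rectpath a b)) f"
  defines "a2 \<equiv> Complex (Re b) (Im a)" and "a4 \<equiv> Complex (Re a) (Im b)"
  shows "contour_integral (rectpath a b) f =
     contour_integral (linepath a a2) f + contour_integral (linepath a2 b) f +
     contour_integral (linepath b a4) f + contour_integral (linepath a4 a) f"
proof -
  have img: "path_image (rectpath a b) =
     closed_segment a a2 \<union> closed_segment a2 b \<union> closed_segment b a4 \<union> closed_segment a4 a"
    unfolding rectpath_def Let_def a2_def[symmetric] a4_def[symmetric]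
    by (simp add: path_image_join Un_assoc)
  have int: "f contour_integrable_on linepath a a2" "f contour_integrable_on linepath a2 b"
    "f contour_integrable_on linepath b a4" "f contour_integrable_on linepath a4 a"
    by (intro contour_integrable_continuous_linepath continuous_on_subset[OF assms(1)]; force simp: img)+
  then show ?thesis
    unfolding rectpath_def Let_def a2_def[symmetric] a4_def[symmetric]
    by (simp add: contour_integrable_joinI)
qed

text \<open>
  Subtracting the exponential with parameter \<open>1\<close> makes the exponential factor vanish at \<open>0\<close>, which
  cancels the pole of the quotient there. The price is that only \<open>\<sigma>\<^sub>p(t) - \<sigma>\<^sub>p(1)\<close> is obtained; the constant \<open>\<sigma>\<^sub>p(1)\<close>
  affects only the first Bernoulli number.
\<close>
definition exp_difference :: "real \<Rightarrow> complex \<Rightarrow> complex" where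
  "exp_difference t z = exp (- (z * of_real t)) - exp (- z)"

definition exp_difference_quotient :: "real \<Rightarrow> complex \<Rightarrow> complex" where
  "exp_difference_quotient t z = (if z = 0 then of_real (1 - t) else exp_difference t z / z)"

text \<open>
  Away from \<open>0\<close> this is the quotient times the difference of exponentials; in this form it is holomorphic
  at \<open>0\<close>.
\<close>
definition contour_integrand :: "real \<Rightarrow> real \<Rightarrow> complex \<Rightarrow> complex" where
  "contour_integrand p t z = koshliakov_num p z * exp_difference_quotient t z / koshliakov_den_quotient p z"

lemma exp_difference_quotient_holomorphic: "exp_difference_quotient t holomorphic_on UNIV"
  unfolding exp_difference_quotient_def[abs_def]
proof (rule holomorphic_divide_id)
  show "exp_difference t holomorphic_on UNIV"
    unfolding exp_difference_def[abs_def] by (intro holomorphic_intros)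
  show "(exp_difference t has_field_derivative of_real (1 - t)) (at 0)"
    unfolding exp_difference_def[abs_def] by (auto intro!: derivative_eq_intros)
qed (simp add: exp_difference_def)

lemma contour_integrand_eq:
  assumes "z \<noteq> 0"
  shows "contour_integrand p t z = koshliakov_num p z / koshliakov_den p z * exp_difference t z"
  using assms by (simp add: contour_integrand_def exp_difference_quotient_def koshliakov_den_quotient_def)

lemma norm_exp_difference_le:
  "norm (exp_difference t z) \<le> exp (- (Re z * t)) + exp (- Re z)"
  unfolding exp_difference_def by (rule order_trans[OF norm_triangle_ineq4]) simp

lemma contour_integrand_holomorphic:
  assumes "p > 0"
  shows "contour_integrand p t holomorphic_on {z. Re z > -1/2} - range (\<lambda>j. of_real (koshliakov_root p j))"
  unfolding contour_integrand_def[abs_def]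
  by (intro holomorphic_intros koshliakov_num_holomorphic koshliakov_den_quotient_holomorphic
       holomorphic_on_subset[OF exp_difference_quotient_holomorphic])
     (use koshliakov_den_quotient_eq_0D[OF assms] in auto)

text \<open>
  The roots below \<open>N\<close> are exactly those with index less than \<open>N\<close>, and they lie inside the rectangle
  with corners \<open>- \<i>N\<close> and \<open>N + \<i>N\<close>. Each residue carries a factor \<open>1 / \<pi>\<close>, which
  reduces \<open>2\<pi>\<i>\<close> to \<open>2\<i>\<close>.
\<close>
lemma contour_integral_residues:
  assumes p: "p > 0" and t: "t > 0" "t \<noteq> 1" and N: "N > 0"
  shows "contour_integral (rectpath (Complex 0 (- real N)) (Complex (real N) (real N))) (contour_integrand p t) =
     2 * \<i> * (\<Sum>j<N. of_real (koshliakov_weight p j) * exp_difference t (of_real (koshliakov_root p j)))"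
    and "continuous_on (path_image (rectpath (Complex 0 (- real N)) (Complex (real N) (real N)))) (contour_integrand p t)"
proof -
  \<comment> \<open>The residue theorem is applied in a strip that contains only the roots inside the rectangle: no zero has real part in \<open>(-1/2, 0)\<close> or in \<open>(N, N + 1/2)\<close>.\<close>
  define S where "S = {z. Re z > -1/2} \<inter> {z. Re z < real N + 1/2}"
  define r where "r = (\<lambda>j. complex_of_real (koshliakov_root p j))"
  define pts where "pts = r ` {..<N}"
  define g where "g = rectpath (Complex 0 (- real N)) (Complex (real N) (real N))"
  have r_bounds: "real j + 1/2 < Re (r j)" "Re (r j) < real j + 1" "Im (r j) = 0" for j
    using koshliakov_root_enumeration(3)[OF p, of j] by (auto simp: r_def)
  have inj: "inj_on r {..<N}"
  proof (rule inj_onI)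
    fix i j assume "r i = r j"
    then show "i = j"
      using koshliakov_root_enumeration(1)[OF p] by (simp add: r_def strict_mono_eq)
  qed
  have "S \<inter> range r \<subseteq> pts"
  proof
    fix z assume "z \<in> S \<inter> range r"
    then obtain j where j: "z = r j" "Re z < real N + 1/2" by (auto simp: S_def)
    then have "j < N" using r_bounds(1)[of j] by simp
    then show "z \<in> pts" using j by (simp add: pts_def)
  qed
  then have hol: "contour_integrand p t holomorphic_on S - pts"
    by (intro holomorphic_on_subset[OF contour_integrand_holomorphic[OF p]]) (auto simp: S_def r_def)
  have box: "pts \<subseteq> box (Complex 0 (- real N)) (Complex (real N) (real N))"
  proof
    fix z assume "z \<in> pts"
    then obtain j where j: "z = r j" "j < N" by (auto simp: pts_def)
    moreover have "real j + 1 \<le> real N" using j(2) by simp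
    ultimately show "z \<in> box (Complex 0 (- real N)) (Complex (real N) (real N))"
      using r_bounds[of j] N by (simp add: in_box_complex_iff)
  qed
  have img: "path_image g = cbox (Complex 0 (- real N)) (Complex (real N) (real N)) - box (Complex 0 (- real N)) (Complex (real N) (real N))"
    unfolding g_def by (rule path_image_rectpath_cbox_minus_box) auto
  have cbox: "cbox (Complex 0 (- real N)) (Complex (real N) (real N)) \<subseteq> S"
    by (auto simp: S_def in_cbox_complex_iff)
  have img_sub: "path_image g \<subseteq> S - pts"
    using img cbox box by blast
  show "continuous_on (path_image (rectpath (Complex 0 (- real N)) (Complex (real N) (real N)))) (contour_integrand p t)"
    using holomorphic_on_imp_continuous_on[OF hol] continuous_on_subset img_sub unfolding g_def by blast
  have "contour_integral g (contour_integrand p t) =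
     2 * pi * \<i> * (\<Sum>z\<in>pts. winding_number g z * residue (contour_integrand p t) z)"
  proof (rule Residue_theorem)
    show "open S"
      unfolding S_def by (intro open_Int open_halfspace_Re_gt open_halfspace_Re_lt)
    have "convex S"
      unfolding S_def by (intro convex_Int convex_halfspace_Re_gt convex_halfspace_Re_lt)
    then show "connected S" by (rule convex_connected)
    show "\<forall>z. z \<notin> S \<longrightarrow> winding_number g z = 0"
      unfolding g_def using cbox by (auto intro!: winding_number_rectpath_outside)
  qed (use hol img_sub in \<open>auto simp: pts_def g_def\<close>)
  also have "(\<Sum>z\<in>pts. winding_number g z * residue (contour_integrand p t) z) =
     (\<Sum>z\<in>pts. residue (contour_integrand p t) z)"
    using box by (intro sum.cong refl) (auto simp: g_def winding_number_rectpath)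
  also have "\<dots> = (\<Sum>j<N. residue (contour_integrand p t) (r j))"
    unfolding pts_def by (simp add: sum.reindex[OF inj])
  also have "\<dots> = (\<Sum>j<N. of_real (koshliakov_weight p j) * exp_difference t (r j) / of_real pi)"
  proof (intro sum.cong refl)
    fix j
    have rj: "r j \<noteq> 0" "koshliakov_root p j > 0"
      using r_bounds(1)[of j] koshliakov_root_eq(2)[OF p, of j] by auto
    have "exp_difference t (r j) = of_real (exp (- (koshliakov_root p j * t)) - exp (- koshliakov_root p j))"
      by (simp add: exp_difference_def r_def flip: exp_of_real)
    moreover have "exp (- (koshliakov_root p j * t)) \<noteq> exp (- koshliakov_root p j)"
      using rj t by simp
    ultimately have "exp_difference t (r j) \<noteq> 0"
      by (simp only: of_real_eq_0_iff right_minus_eq simp_thms)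
    then have "exp_difference_quotient t (r j) \<noteq> 0"
      using rj by (simp add: exp_difference_quotient_def)
    then have "residue (contour_integrand p t) (r j) =
      of_real (koshliakov_weight p j / pi) * (r j * exp_difference_quotient t (r j))"
      unfolding contour_integrand_def[abs_def] r_def
      by (intro koshliakov_residue p exp_difference_quotient_holomorphic)
    also have "r j * exp_difference_quotient t (r j) = exp_difference t (r j)"
      using rj by (simp add: exp_difference_quotient_def)
    finally show "residue (contour_integrand p t) (r j) = of_real (koshliakov_weight p j) * exp_difference t (r j) / of_real pi"
      by simp
  qed
  finally show "contour_integral (rectpath (Complex 0 (- real N)) (Complex (real N) (real N))) (contour_integrand p t) =
     2 * \<i> * (\<Sum>j<N. of_real (koshliakov_weight p j) * exp_difference t (of_real (koshliakov_root p j)))"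
    unfolding g_def r_def by (simp flip: sum_divide_distrib)
qed

definition exp_difference_primitive :: "real \<Rightarrow> complex \<Rightarrow> complex" where
  "exp_difference_primitive t z = \<i> * (exp (- (z * of_real t)) / of_real t - exp (- z))"

lemma exp_difference_primitive_deriv:
  assumes "t > 0"
  shows "(exp_difference_primitive t has_field_derivative (- \<i> * exp_difference t z)) (at z within A)"
  unfolding exp_difference_primitive_def[abs_def] exp_difference_def using assms
  by (auto intro!: derivative_eq_intros simp: algebra_simps)

text \<open>
  Far from the real axis the quotient is close to the constant \<open>-c\<i>\<close>, with \<open>c = 1\<close> above and
  \<open>c = -1\<close> below. Replacing it by the constant leaves an integral with an explicit primitive.
\<close>
lemma contour_integral_horizontal_edge:
  assumes t: "t > 0" and c: "c = 1 \<or> c = -1" and M: "M \<ge> 0" and ends: "Re a \<ge> 0" "Re b \<ge> 0" 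
    and near: "\<And>z. z \<in> closed_segment a b \<Longrightarrow> z \<noteq> 0 \<and> norm (koshliakov_num p z / koshliakov_den p z + c * \<i>) \<le> M"
    and int: "contour_integrand p t contour_integrable_on linepath a b"
  shows "norm (contour_integral (linepath a b) (contour_integrand p t) -
            c * (exp_difference_primitive t b - exp_difference_primitive t a)) \<le> 2 * M * norm (b - a)"
proof -
  have "((\<lambda>z. c * (- \<i> * exp_difference t z)) has_contour_integral
          c * (exp_difference_primitive t (pathfinish (linepath a b)) - exp_difference_primitive t (pathstart (linepath a b)))) (linepath a b)"
    by (intro has_contour_integral_lmul contour_integral_primitive[where S = UNIV] exp_difference_primitive_deriv t) auto
  then have "((\<lambda>z. contour_integrand p t z - c * (- \<i> * exp_difference t z)) has_contour_integral
     (contour_integral (linepath a b) (contour_integrand p t) - c * (exp_difference_primitive t b - exp_difference_primitive t a))) (linepath a b)"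
    by (intro has_contour_integral_diff has_contour_integral_integral int) auto
  then show ?thesis
  proof (rule has_contour_integral_bound_linepath)
    fix z assume z: "z \<in> closed_segment a b"
    then have Re: "Re z \<ge> 0"
    proof -
      have "closed_segment a b \<subseteq> {z. Re z \<ge> 0}"
        using ends by (intro closed_segment_subset convex_halfspace_Re_ge) auto
      then show ?thesis using z by auto
    qed
    have "contour_integrand p t z - c * (- \<i> * exp_difference t z) = (koshliakov_num p z / koshliakov_den p z + c * \<i>) * exp_difference t z"
      using near[OF z] by (simp add: contour_integrand_eq algebra_simps)
    then have "norm (contour_integrand p t z - c * (- \<i> * exp_difference t z)) =
       norm (koshliakov_num p z / koshliakov_den p z + c * \<i>) * norm (exp_difference t z)"
      by (simp add: norm_mult)
    also have "\<dots> \<le> M * 2"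
    proof (rule mult_mono)
      have "exp (- (Re z * t)) \<le> 1" "exp (- Re z) \<le> 1" using Re t by auto
      then show "norm (exp_difference t z) \<le> 2"
        using norm_exp_difference_le[of t z] by linarith
    qed (use near[OF z] M in auto)
    finally show "norm (contour_integrand p t z - c * (- \<i> * exp_difference t z)) \<le> 2 * M" by simp
  qed (use M in auto)
qed

text \<open>
  The values at \<open>\<i>y\<close> and \<open>- \<i>y\<close> are complex conjugates, so folding the left edge at \<open>0\<close> leaves twice
  the real part, in which the quotient \<open>-\<i> (1 + 2h)\<close> selects the sines.
\<close>
lemma contour_integrand_folded_imag_axis:
  assumes p: "p > 0" and y: "y > 0"
  shows "contour_integrand p t (Complex 0 y) + contour_integrand p t (Complex 0 (- y)) =
     of_real (- 2 * ((sin (y * t) - sin y) + 2 * (koshliakov_kernel p y * (sin (y * t) - sin y))))"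
proof -
  define w where "w = contour_integrand p t (Complex 0 y)"
  have c: "Complex 0 y = \<i> * of_real y" by (simp add: complex_eq_iff)
  have nz: "Complex 0 y \<noteq> 0" "cnj (Complex 0 y) \<noteq> 0" using y by (simp_all add: complex_eq_iff)
  have cnj: "Complex 0 (- y) = cnj (Complex 0 y)" by (simp add: complex_eq_iff)
  have "contour_integrand p t (Complex 0 (- y)) = cnj w"
    unfolding cnj w_def contour_integrand_eq[OF nz(1)] contour_integrand_eq[OF nz(2)]
    by (simp add: koshliakov_num_cnj koshliakov_den_cnj exp_difference_def exp_cnj del: complex_cnj)
  then have "contour_integrand p t (Complex 0 y) + contour_integrand p t (Complex 0 (- y)) = of_real (2 * Re w)"
    by (simp add: w_def complex_eq_iff)
  also have "w = - \<i> * of_real (1 + 2 * koshliakov_kernel p y) * exp_difference t (Complex 0 y)"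
    using contour_integrand_eq[OF nz(1), of p t] koshliakov_quotient_imag_axis[OF p y]
    by (simp only: w_def c)
  also have "Re \<dots> = (1 + 2 * koshliakov_kernel p y) * Im (exp_difference t (Complex 0 y))"
    by simp
  also have "Im (exp_difference t (Complex 0 y)) = sin y - sin (y * t)"
    by (simp add: exp_difference_def Im_exp)
  finally show ?thesis by (simp add: algebra_simps)
qed

lemma koshliakov_sine_integrable:
  assumes p: "p > 0" and t: "t > 0"
  shows "set_integrable lborel {0<..} (\<lambda>y. koshliakov_kernel p y * (sin (y * t) - sin y))"
proof (rule koshliakov_kernel_integrable[OF p, where C = "t + 1" and n = 0])
  fix y :: real assume y: "y > 0"
  have "\<bar>sin (y * t)\<bar> \<le> y * t" "\<bar>sin y\<bar> \<le> y"
    using abs_sin_x_le_abs_x[of "y * t"] abs_sin_x_le_abs_x[of y] y t by (simp_all add: abs_mult)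
  then show "\<bar>sin (y * t) - sin y\<bar> \<le> (t + 1) * y * y ^ 0"
    by (simp add: algebra_simps)
qed (intro continuous_intros)

lemma integral_left_edge:
  assumes p: "p > 0" and t: "t > 0" and N: "N > 0"
    and cont: "continuous_on {- real N..real N} (\<lambda>y. contour_integrand p t (Complex 0 y))"
  shows "integral {- real N..real N} (\<lambda>y. contour_integrand p t (Complex 0 y)) =
     of_real (- 2 * (((1 - cos (real N * t)) / t - (1 - cos (real N))) +
        2 * (LBINT y:{0..real N}. koshliakov_kernel p y * (sin (y * t) - sin y))))"
proof -
  define F where "F = (\<lambda>y. contour_integrand p t (Complex 0 y))"
  define k where "k = (\<lambda>y. koshliakov_kernel p y * (sin (y * t) - sin y))"
  define K where "K = (LBINT y:{0..real N}. k y)"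
  define S where "S = (1 - cos (real N * t)) / t - (1 - cos (real N))"
  have "set_integrable lborel {0<..} k"
    unfolding k_def by (rule koshliakov_sine_integrable[OF p t])
  then have k_int': "set_integrable lborel {0<..real N} k"
    by (rule set_integrable_subset) auto
  have ind: "indicator {0<..real N} y *\<^sub>R k y = indicator {0..real N} y *\<^sub>R k y" for y
    by (auto simp: indicator_def k_def)
  have k_int: "set_integrable lborel {0..real N} k"
    using k_int' unfolding set_integrable_def ind .
  have k_has: "(k has_integral K) {0..real N}"
    using set_borel_integral_eq_integral[OF k_int] unfolding K_def by (simp add: has_integral_integral)
  have S_has: "((\<lambda>y. sin (y * t) - sin y) has_integral S) {0..real N}"
  proof -
    have "((\<lambda>y. sin (y * t) - sin y) has_integral
        ((- cos (real N * t) / t + cos (real N)) - (- cos (0 * t) / t + cos 0))) {0..real N}"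
    proof (rule fundamental_theorem_of_calculus)
      fix y :: real
      show "((\<lambda>y. - cos (y * t) / t + cos y) has_vector_derivative sin (y * t) - sin y) (at y within {0..real N})"
        using t by (auto intro!: derivative_eq_intros simp flip: has_real_derivative_iff_has_vector_derivative)
    qed simp
    moreover have "(- cos (real N * t) / t + cos (real N)) - (- cos (0 * t) / t + cos 0) = S"
      by (simp add: S_def diff_divide_distrib)
    ultimately show ?thesis by simp
  qed
  have "((\<lambda>y. complex_of_real (- 2 * ((sin (y * t) - sin y) + 2 * k y))) has_integral of_real (- 2 * (S + 2 * K))) {0..real N}"
    by (intro has_integral_of_real has_integral_mult_right has_integral_add S_has k_has)
  then have sum_has: "((\<lambda>y. F y + F (- y)) has_integral of_real (- 2 * (S + 2 * K))) {0..real N}"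
  proof (rule has_integral_spike[of "{0}", rotated 2])
    fix y assume "y \<in> {0..real N} - {0}"
    then have "y > 0" by auto
    then show "F y + F (- y) = complex_of_real (- 2 * ((sin (y * t) - sin y) + 2 * k y))"
      unfolding F_def k_def by (rule contour_integrand_folded_imag_axis[OF p])
  qed simp
  have F_int: "F integrable_on {- real N..real N}"
    unfolding F_def by (rule integrable_continuous_real[OF cont])
  have F_int': "F integrable_on {0..real N}" "F integrable_on {- real N..0}"
    by (auto intro: integrable_on_subinterval[OF F_int])
  have refl: "(\<lambda>y. F (- y)) integrable_on {0..real N}" "integral {0..real N} (\<lambda>y. F (- y)) = integral {- real N..0} F"
    using F_int'(2) Henstock_Kurzweil_Integration.integrable_reflect_real[where a = "- real N" and b = 0 and f = F]
      Henstock_Kurzweil_Integration.integral_reflect_real[where a = "- real N" and b = 0 and f = F]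
    by (simp_all only: minus_zero minus_minus)
  have "integral {- real N..real N} F = integral {- real N..0} F + integral {0..real N} F"
    using Henstock_Kurzweil_Integration.integral_combine[OF _ _ F_int, of 0] by simp
  also have "\<dots> = integral {0..real N} (\<lambda>y. F y + F (- y))"
    unfolding refl(2)[symmetric] by (simp add: integral_add[OF F_int'(1) refl(1)])
  also have "\<dots> = of_real (- 2 * (S + 2 * K))"
    by (rule integral_unique[OF sum_has])
  finally show ?thesis unfolding F_def S_def K_def k_def .
qed

text \<open>
  The integral over the right edge is small because of the factors \<open>e\<^bsup>-Nt\<^esup>\<close> and \<open>e\<^bsup>-N\<^esup>\<close>. On the
  horizontal edges the quotient is constant up to \<open>O(e\<^bsup>-2\<pi>N\<^esup>)\<close>. The oscillating terms
  \<open>cos (Nt) / t - cos N\<close> that the primitives leave at the corners \<open>\<plusminus> \<i>N\<close> cancel those from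
  integrating \<open>sin (ty) - sin y\<close> along the left edge, and \<open>1 / t - 1\<close> remains.
\<close>
lemma koshliakov_sigma_partial_sum_bound:
  assumes p: "p > 0" and t: "t > 0" "t \<noteq> 1" and N: "N > 0"
  defines "e \<equiv> exp (- (2 * pi * real N))"
  shows "norm ((\<Sum>j<N. of_real (koshliakov_weight p j) * exp_difference t (of_real (koshliakov_root p j))) -
     of_real (1 / t - 1 + 2 * (LBINT y:{0..real N}. koshliakov_kernel p y * (sin (y * t) - sin y))))
    \<le> 4 * real N * (e / (1 - e)) + (p + 2) * real N * (exp (- (real N * t)) + exp (- real N))
        + (exp (- (real N * t)) / t + exp (- real N))"
proof -
  define a1 where "a1 = Complex 0 (- real N)"
  define a2 where "a2 = Complex (real N) (- real N)"
  define a3 where "a3 = Complex (real N) (real N)"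
  define a4 where "a4 = Complex 0 (real N)"
  define F where "F = contour_integrand p t"
  define P where "P = exp_difference_primitive t"
  define \<Sigma> where "\<Sigma> = (\<Sum>j<N. of_real (koshliakov_weight p j) * exp_difference t (of_real (koshliakov_root p j)))"
  define K where "K = (LBINT y:{0..real N}. koshliakov_kernel p y * (sin (y * t) - sin y))"
  define S where "S = (1 - cos (real N * t)) / t - (1 - cos (real N))"
  define bottom where "bottom = contour_integral (linepath a1 a2) F"
  define right where "right = contour_integral (linepath a2 a3) F"
  define top where "top = contour_integral (linepath a3 a4) F"
  define left where "left = contour_integral (linepath a4 a1) F"
  have e: "0 < e" "e < 1" using N by (simp_all add: e_def)
  note res = contour_integral_residues[OF p t N, folded a1_def a3_def F_def]
  have img: "path_image (rectpath a1 a3) =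
     closed_segment a1 a2 \<union> closed_segment a2 a3 \<union> closed_segment a3 a4 \<union> closed_segment a4 a1"
    unfolding rectpath_def Let_def a1_def a2_def a3_def a4_def
    by (simp add: path_image_join Un_assoc)
  have int: "F contour_integrable_on linepath a1 a2" "F contour_integrable_on linepath a2 a3"
    "F contour_integrable_on linepath a3 a4" "F contour_integrable_on linepath a4 a1"
    by (intro contour_integrable_continuous_linepath continuous_on_subset[OF res(2)]; force simp: img)+
  have total: "2 * \<i> * \<Sigma> = bottom + right + top + left"
    using contour_integral_rectpath[OF res(2)] res(1)
    by (simp add: \<Sigma>_def bottom_def right_def top_def left_def a1_def a2_def a3_def a4_def)
  have seg_top: "Im z = real N" if "z \<in> closed_segment a3 a4" for z
    using that closed_segment_same_Im[of a3 a4] by (auto simp: a3_def a4_def)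
  have seg_bottom: "Im z = - real N" if "z \<in> closed_segment a1 a2" for z
    using that closed_segment_same_Im[of a1 a2] by (auto simp: a1_def a2_def)
  have seg_right: "Re z = real N" "\<bar>Im z\<bar> \<le> real N" if "z \<in> closed_segment a2 a3" for z
    using that closed_segment_same_Re[of a2 a3] by (auto simp: a2_def a3_def closed_segment_eq_real_ivl)
  have top: "norm (top - 1 * (P a4 - P a3)) \<le> 2 * (2 * e / (1 - e)) * norm (a4 - a3)"
    unfolding top_def P_def F_def
  proof (rule contour_integral_horizontal_edge)
    fix z assume "z \<in> closed_segment a3 a4"
    then have z: "Im z = real N" by (rule seg_top)
    then have "z \<noteq> 0" using N by auto
    then show "z \<noteq> 0 \<and> norm (koshliakov_num p z / koshliakov_den p z + 1 * \<i>) \<le> 2 * e / (1 - e)"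
      using koshliakov_quotient_upper_half_plane(2)[OF p, of z] z N by (simp add: e_def)
  qed (use t e int in \<open>auto simp: a3_def a4_def F_def\<close>)
  have bottom: "norm (bottom - (- 1) * (P a2 - P a1)) \<le> 2 * (2 * e / (1 - e)) * norm (a2 - a1)"
    unfolding bottom_def P_def F_def
  proof (rule contour_integral_horizontal_edge)
    fix z assume "z \<in> closed_segment a1 a2"
    then have z: "Im z = - real N" by (rule seg_bottom)
    then have "z \<noteq> 0" using N by auto
    then show "z \<noteq> 0 \<and> norm (koshliakov_num p z / koshliakov_den p z + (- 1) * \<i>) \<le> 2 * e / (1 - e)"
      using koshliakov_quotient_lower_half_plane[OF p, of z] z N by (simp add: e_def)
  qed (use t e int in \<open>auto simp: a1_def a2_def F_def\<close>)
  have right: "norm right \<le> (p + 2) * (exp (- (real N * t)) + exp (- real N)) * norm (a3 - a2)"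
    unfolding right_def
  proof (rule contour_integral_bound_linepath[OF int(2)])
    fix z assume "z \<in> closed_segment a2 a3"
    then have z: "Re z = real N" "\<bar>Im z\<bar> \<le> real N" by (rule seg_right)+
    then have nz: "z \<noteq> 0" using N by auto
    have "norm (F z) = norm (koshliakov_num p z / koshliakov_den p z) * norm (exp_difference t z)"
      unfolding F_def contour_integrand_eq[OF nz] norm_mult ..
    also have "\<dots> \<le> (p + 2) * (exp (- (real N * t)) + exp (- real N))"
      using koshliakov_quotient_vertical_line(2)[OF p N z] norm_exp_difference_le[of t z] p z
      by (intro mult_mono) auto
    finally show "norm (F z) \<le> (p + 2) * (exp (- (real N * t)) + exp (- real N))" .
  qed (use p in simp)
  have left: "left = 2 * \<i> * of_real (S + 2 * K)"
  proof -
    have "left = - contour_integral (linepath a1 a4) F"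
      unfolding left_def by (rule contour_integral_reverse_linepath) 
         (intro continuous_on_subset[OF res(2)]; force simp: img)
    also have "contour_integral (linepath a1 a4) F = \<i> * integral {- real N..real N} (\<lambda>y. F (Complex 0 y))"
      by (rule contour_integral_linepath_same_Re) (use N in \<open>auto simp: a1_def a4_def\<close>)
    also have "integral {- real N..real N} (\<lambda>y. F (Complex 0 y)) = of_real (- 2 * (S + 2 * K))"
      unfolding F_def S_def K_def
    proof (rule integral_left_edge[OF p t(1) N])
      have "continuous_on {- real N..real N} (\<lambda>y. F (Complex 0 y))"
      proof (rule continuous_on_compose2[OF res(2)])
        show "Complex 0 ` {- real N..real N} \<subseteq> path_image (rectpath a1 a3)"
          using N by (subst path_image_rectpath) (auto simp: a1_def a3_def)
      qed (auto intro!: continuous_intros)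
      then show "continuous_on {- real N..real N} (\<lambda>y. contour_integrand p t (Complex 0 y))"
        unfolding F_def .
    qed
    finally show ?thesis by (simp add: algebra_simps)
  qed
  have corners: "P a4 + P a1 = 2 * \<i> * of_real (cos (real N * t) / t - cos (real N))"
  proof -
    have "exp (- (a4 * of_real t)) + exp (- (a1 * of_real t)) = of_real (2 * cos (real N * t))"
      by (simp add: complex_eq_iff a1_def a4_def Re_exp Im_exp)
    moreover have "exp (- a4) + exp (- a1) = of_real (2 * cos (real N))"
      by (simp add: complex_eq_iff a1_def a4_def Re_exp Im_exp)
    moreover have "P a4 + P a1 = \<i> * ((exp (- (a4 * of_real t)) + exp (- (a1 * of_real t))) / of_real t - (exp (- a4) + exp (- a1)))"
      by (simp add: P_def exp_difference_primitive_def algebra_simps add_divide_distrib)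
    ultimately show ?thesis by (simp add: algebra_simps)
  qed
  have P_right: "norm (P z) \<le> exp (- (real N * t)) / t + exp (- real N)" if "Re z = real N" for z
  proof -
    have "norm (P z) \<le> norm (exp (- (z * of_real t)) / of_real t) + norm (exp (- z))"
      unfolding P_def exp_difference_primitive_def norm_mult norm_ii mult_1
      by (rule norm_triangle_ineq4)
    then show ?thesis using that t by (simp add: norm_divide)
  qed
  have S_eq: "S + (cos (real N * t) / t - cos (real N)) = 1 / t - 1"
    by (simp add: S_def diff_divide_distrib)
  define X where "X = complex_of_real (1 / t - 1 + 2 * K)"
  have "2 * \<i> * (\<Sigma> - X) = (top - 1 * (P a4 - P a3)) + (bottom - (- 1) * (P a2 - P a1)) + right - P a3 - P a2"
  proof -
    have "2 * \<i> * X = 2 * \<i> * of_real (S + 2 * K) + 2 * \<i> * of_real (cos (real N * t) / t - cos (real N))"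
      unfolding X_def S_eq[symmetric] by (simp add: algebra_simps)
    also have "\<dots> = left + (P a4 + P a1)" unfolding left corners ..
    finally show ?thesis using total by (simp add: algebra_simps)
  qed
  then have "norm (2 * \<i> * (\<Sigma> - X)) \<le> norm (top - 1 * (P a4 - P a3)) + norm (bottom - (- 1) * (P a2 - P a1)) + norm right + norm (P a3) + norm (P a2)"
    by (simp only:) (intro order_trans[OF norm_triangle_ineq4] order_trans[OF norm_triangle_ineq] add_mono order_refl)
  moreover have "norm (P a3) \<le> exp (- (real N * t)) / t + exp (- real N)" "norm (P a2) \<le> exp (- (real N * t)) / t + exp (- real N)"
    by (intro P_right; simp add: a2_def a3_def)+
  moreover have "norm (a4 - a3) = real N" "norm (a2 - a1) = real N" "norm (a3 - a2) = 2 * real N"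
    by (simp_all add: a1_def a2_def a3_def a4_def cmod_def real_sqrt_mult)
  ultimately have "2 * norm (\<Sigma> - X) \<le> 2 * (2 * (2 * e / (1 - e)) * real N) + (p + 2) * (exp (- (real N * t)) + exp (- real N)) * (2 * real N)
      + 2 * (exp (- (real N * t)) / t + exp (- real N))"
    using top bottom right by (simp add: norm_mult)
  also have "\<dots> = 2 * (4 * real N * (e / (1 - e)) + (p + 2) * real N * (exp (- (real N * t)) + exp (- real N))
        + (exp (- (real N * t)) / t + exp (- real N)))"
    by (simp add: algebra_simps)
  finally show ?thesis
    unfolding \<Sigma>_def[symmetric] K_def[symmetric] X_def[symmetric] by (simp only: mult_le_cancel_left_pos zero_less_numeral)
qed

text \<open>
  Let \<open>N\<close> tend to infinity in the preceding bound.
\<close>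
theorem koshliakov_sigma_formula:
  assumes p: "p > 0" and t: "t > 0" "t \<noteq> 1"
  shows "koshliakov_sigma p (of_real t) - koshliakov_sigma p 1 =
    of_real (1 / t - 1 + 2 * (LBINT y:{0<..}. koshliakov_kernel p y * (sin (y * t) - sin y)))"
proof -
  define k where "k = (\<lambda>y. koshliakov_kernel p y * (sin (y * t) - sin y))"
  define e where "e = (\<lambda>N. exp (- (2 * pi * real N)))"
  define \<Sigma> where "\<Sigma> = (\<lambda>N. \<Sum>j<N. of_real (koshliakov_weight p j) * exp_difference t (of_real (koshliakov_root p j)))"
  define X where "X = (\<lambda>K. complex_of_real (1 / t - 1 + 2 * K))"
  interpret exp_dominated_series "\<lambda>j t. of_real (koshliakov_weight p j) * exp (- (of_real (koshliakov_root p j) * of_real t))"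
    by (rule koshliakov_sigma_series[OF p])
  have \<sigma>: "(\<lambda>j. of_real (koshliakov_weight p j) * exp (- (of_real (koshliakov_root p j) * of_real u))) sums koshliakov_sigma p (of_real u)"
    if "u > 0" for u :: real
    unfolding koshliakov_sigma_def using summable_norm_cancel[OF summable_norm_term[OF that]]
    by (rule summable_sums)
  have "(\<lambda>j. of_real (koshliakov_weight p j) * exp (- (of_real (koshliakov_root p j) * of_real t)) -
             of_real (koshliakov_weight p j) * exp (- (of_real (koshliakov_root p j) * of_real 1))) sums
        (koshliakov_sigma p (of_real t) - koshliakov_sigma p (of_real 1))"
    using t by (intro sums_diff \<sigma>) auto
  then have lim_\<Sigma>: "\<Sigma> \<longlonglongrightarrow> koshliakov_sigma p (of_real t) - koshliakov_sigma p 1"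
    by (simp add: \<Sigma>_def exp_difference_def sums_def right_diff_distrib)
  have ind: "indicator {0<..} y *\<^sub>R k y = indicator {0..} y *\<^sub>R k y" for y
    by (auto simp: indicator_def k_def)
  have int: "set_integrable lborel {0..} k"
    using koshliakov_sine_integrable[OF p t(1), folded k_def] unfolding set_integrable_def ind .
  have "((\<lambda>b. LBINT y:{0..b}. k y) \<longlongrightarrow> (LBINT y:{0..}. k y)) at_top"
    by (rule tendsto_set_lebesgue_integral_at_top[OF _ int]) simp
  then have "(\<lambda>N. LBINT y:{0..real N}. k y) \<longlonglongrightarrow> (LBINT y:{0..}. k y)"
    by (rule filterlim_compose) (rule filterlim_real_sequentially)
  also have "(LBINT y:{0..}. k y) = (LBINT y:{0<..}. k y)"
    unfolding set_lebesgue_integral_def ind ..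
  finally have lim_X: "(\<lambda>N. X (LBINT y:{0..real N}. k y)) \<longlonglongrightarrow> X (LBINT y:{0<..}. k y)"
    unfolding X_def by (intro tendsto_intros)
  have "(\<lambda>N. \<Sigma> N - X (LBINT y:{0..real N}. k y)) \<longlonglongrightarrow> 0"
  proof (rule Lim_null_comparison)
    show "eventually (\<lambda>N. norm (\<Sigma> N - X (LBINT y:{0..real N}. k y)) \<le>
      4 * real N * (e N / (1 - e N)) + (p + 2) * real N * (exp (- (real N * t)) + exp (- real N))
        + (exp (- (real N * t)) / t + exp (- real N))) sequentially"
      using eventually_gt_at_top[of 0]
      by eventually_elim (unfold \<Sigma>_def X_def k_def e_def, rule koshliakov_sigma_partial_sum_bound[OF p t])
    have exp_lim: "(\<lambda>N. exp (- (real N * c))) \<longlonglongrightarrow> 0" "(\<lambda>N. real N * exp (- (real N * c))) \<longlonglongrightarrow> 0" if "c > 0" for c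
      using that by real_asymp+
    have e_lim: "(\<lambda>N. real N * e N) \<longlonglongrightarrow> 0" "e \<longlonglongrightarrow> 0"
      unfolding e_def using exp_lim[of "2 * pi"] by (simp_all add: mult_ac)
    have "(\<lambda>N. 4 * ((real N * e N) / (1 - e N)) + (p + 2) * (real N * exp (- (real N * t)) + real N * exp (- (real N * 1)))
        + (exp (- (real N * t)) / t + exp (- (real N * 1)))) \<longlonglongrightarrow> 4 * (0 / (1 - 0)) + (p + 2) * (0 + 0) + (0 / t + 0)"
      using t by (intro tendsto_intros exp_lim e_lim) auto
    then show "(\<lambda>N. 4 * real N * (e N / (1 - e N)) + (p + 2) * real N * (exp (- (real N * t)) + exp (- real N))
        + (exp (- (real N * t)) / t + exp (- real N))) \<longlonglongrightarrow> 0"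
      by (simp add: algebra_simps)
  qed
  from tendsto_add[OF this lim_X] have "\<Sigma> \<longlonglongrightarrow> X (LBINT y:{0<..}. k y)"
    by simp
  then show ?thesis
    using LIMSEQ_unique[OF lim_\<Sigma>] unfolding X_def k_def by blast
qed

section \<open>The generalized Bernoulli numbers as moments\<close>

definition koshliakov_moment :: "real \<Rightarrow> nat \<Rightarrow> real" where
  "koshliakov_moment p n = (LBINT y:{0<..}. koshliakov_kernel p y * y ^ n)"

lemma koshliakov_abs_moment:
  assumes p: "p > 0"
  shows "set_integrable lborel {0<..} (\<lambda>y. koshliakov_kernel p y * y ^ Suc n)"
    and "(LBINT y:{0<..}. \<bar>koshliakov_kernel p y * y ^ Suc n\<bar>) \<le> fact n"
proof -
  show int: "set_integrable lborel {0<..} (\<lambda>y. koshliakov_kernel p y * y ^ Suc n)"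
    by (rule koshliakov_kernel_integrable[OF p, where C = 1 and n = n]) (auto intro!: continuous_intros)
  have G: "set_integrable lborel {0<..} (\<lambda>y. exp (- (pi * y)) * y powr (real (Suc n) - 1))"
     "(LBINT y:{0<..}. exp (- (pi * y)) * y powr (real (Suc n) - 1)) = Gamma (real (Suc n)) / pi powr real (Suc n)"
    by (rule Gamma_integral_scaled_real; simp)+
  have "(LBINT y:{0<..}. \<bar>koshliakov_kernel p y * y ^ Suc n\<bar>) \<le> (LBINT y:{0<..}. exp (- (pi * y)) * y powr (real (Suc n) - 1))"
  proof (rule set_integral_mono)
    show "set_integrable lborel {0<..} (\<lambda>y. \<bar>koshliakov_kernel p y * y ^ Suc n\<bar>)"
      using set_integrable_norm[OF int] by simp
    fix y :: real assume "y \<in> {0<..}"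
    then have y: "y > 0" by simp
    have "\<bar>koshliakov_kernel p y * y ^ Suc n\<bar> = (y * \<bar>koshliakov_kernel p y\<bar>) * y ^ n"
      using y by (simp add: abs_mult)
    also have "\<dots> \<le> exp (- (pi * y)) * y ^ n"
      using y by (intro mult_right_mono koshliakov_kernel_bound p) auto
    finally show "\<bar>koshliakov_kernel p y * y ^ Suc n\<bar> \<le> exp (- (pi * y)) * y powr (real (Suc n) - 1)"
      using y by (simp add: powr_realpow)
  qed (rule G)
  also have "\<dots> = fact n / pi ^ Suc n"
    unfolding G(2) using Gamma_fact[of n, where 'a = real] by (simp add: powr_realpow del: of_nat_Suc power_Suc) (simp add: add.commute)
  also have "\<dots> \<le> fact n"
    using pi_gt3 by (simp add: divide_le_eq_1 mult_le_cancel_left1 divide_le_eq one_le_power del: power_Suc)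
  finally show "(LBINT y:{0<..}. \<bar>koshliakov_kernel p y * y ^ Suc n\<bar>) \<le> fact n" .
qed

text \<open>
  The bound \<open>(n - 1)!\<close> for the moments is beaten by the \<open>n!\<close> in the sine coefficients, so for \<open>t < 1\<close> the
  integrated series converges like a geometric series.
\<close>
lemma sine_transform_sums:
  assumes p: "p > 0" and t: "0 < t" "t < 1"
  shows "(\<lambda>n. sin_coeff n * koshliakov_moment p n * t ^ n) sums (LBINT y:{0<..}. koshliakov_kernel p y * sin (y * t))"
proof -
  define f where "f = (\<lambda>n y. indicator {0<..} y *\<^sub>R (koshliakov_kernel p y * (sin_coeff n * (y * t) ^ n)))"
  have f_alt: "f n y = (sin_coeff n * t ^ n) * (indicator {0<..} y *\<^sub>R (koshliakov_kernel p y * y ^ n))" for n y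
    by (simp add: f_def power_mult_distrib)
  have f_int: "integrable lborel (f n)" for n
  proof (cases n)
    case 0
    then show ?thesis by (simp add: f_def)
  next
    case (Suc k)
    then show ?thesis
      using koshliakov_abs_moment(1)[OF p, of k] unfolding f_alt set_integrable_def by (intro integrable_mult_right) simp
  qed
  have f_val: "(LBINT y. f n y) = sin_coeff n * koshliakov_moment p n * t ^ n" for n
    unfolding f_alt koshliakov_moment_def set_lebesgue_integral_def by simp
  have norm_val: "(LBINT y. norm (f n y)) \<le> t ^ n" for n
  proof (cases n)
    case 0
    then show ?thesis by (simp add: f_def)
  next
    case (Suc k)
    have "norm (f n y) = \<bar>sin_coeff n * t ^ n\<bar> * (indicator {0<..} y *\<^sub>R \<bar>koshliakov_kernel p y * y ^ n\<bar>)" for y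
      by (simp add: f_alt abs_mult)
    then have "(LBINT y. norm (f n y)) = \<bar>sin_coeff n * t ^ n\<bar> * (LBINT y:{0<..}. \<bar>koshliakov_kernel p y * y ^ n\<bar>)"
      by (simp add: set_lebesgue_integral_def)
    also have "\<dots> \<le> \<bar>sin_coeff n * t ^ n\<bar> * fact k"
      unfolding Suc by (intro mult_left_mono koshliakov_abs_moment(2) p) simp
    also have "\<dots> \<le> (1 / fact n * t ^ n) * fact n"
    proof (rule mult_mono)
      show "\<bar>sin_coeff n * t ^ n\<bar> \<le> 1 / fact n * t ^ n"
        using t unfolding abs_mult by (intro mult_mono) (auto simp: sin_coeff_def abs_mult)
      show "(fact k :: real) \<le> fact n" unfolding Suc by (intro fact_mono) simp
    qed (use t in auto)
    finally show ?thesis by simp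
  qed
  have norm_summ: "summable (\<lambda>n. LBINT y. norm (f n y))"
  proof (rule summable_comparison_test'[OF summable_geometric[of t]])
    fix n
    have "(LBINT y. norm (f n y)) \<ge> 0" by (rule integral_nonneg_AE) simp
    then show "norm (LBINT y. norm (f n y)) \<le> t ^ n"
      using norm_val[of n] by simp
  qed (use t in simp)
  have pt_summ: "summable (\<lambda>n. norm (f n y))" for y
    using summable_mult[OF summable_norm_sin[of "y * t"], of "\<bar>indicator {0<..} y * koshliakov_kernel p y\<bar>"]
    by (simp add: f_def abs_mult mult_ac)
  have AE: "AE y in lborel. summable (\<lambda>n. norm (f n y))" using pt_summ by simp
  have "(\<Sum>n. f n y) = indicator {0<..} y *\<^sub>R (koshliakov_kernel p y * sin (y * t))" for y
  proof -
    have "(\<lambda>n. indicator {0<..} y * koshliakov_kernel p y * (sin_coeff n *\<^sub>R (y * t) ^ n)) sums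
        (indicator {0<..} y * koshliakov_kernel p y * sin (y * t))"
      by (intro sums_mult sin_converges)
    then show ?thesis by (simp add: f_def sums_iff mult_ac)
  qed
  then show ?thesis
    using sums_integral[OF f_int AE norm_summ] unfolding f_val set_lebesgue_integral_def by simp
qed

text \<open>
  Multiplying the formula for \<open>\<sigma>\<^sub>p\<close> by \<open>t\<close> gives \<open>1 + C t\<close> plus \<open>2 t\<close> times the expanded sine transform.
  Since the sine has only odd powers, no odd powers beyond the first occur on the right.
\<close>
lemma gen_bernoulli2_sums:
  assumes p: "p > 0"
  shows "\<And>t. 0 < t \<Longrightarrow> t < 1 \<Longrightarrow> (\<lambda>n. complex_of_real (gen_bernoulli2 p n) / fact n * of_real t ^ n) sums
       (of_real t * koshliakov_sigma p (of_real t))"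
    and "\<And>t. 0 < t \<Longrightarrow> t < 1 \<Longrightarrow> summable (\<lambda>n. \<bar>gen_bernoulli2 p n / fact n\<bar> * t ^ n)"
    and "\<And>n. n \<ge> 1 \<Longrightarrow> gen_bernoulli2 p (Suc n) = 2 * fact (Suc n) * sin_coeff n * koshliakov_moment p n"
proof -
  define I where "I = (\<lambda>t. LBINT y:{0<..}. koshliakov_kernel p y * sin (y * t))"
  define C where "C = Re (koshliakov_sigma p 1) - 1 - 2 * I 1"
  define b where "b = (\<lambda>n. case n of 0 \<Rightarrow> 1 | Suc k \<Rightarrow> 2 * (sin_coeff k * koshliakov_moment p k) + (if k = 0 then C else 0))"
  define B where "B = (\<lambda>n. fact n * b n)"
  have real1: "koshliakov_sigma p 1 = of_real (Re (koshliakov_sigma p 1))"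
  proof -
    have eq: "of_real (koshliakov_weight p j) * exp (- (of_real (koshliakov_root p j) * 1)) =
        complex_of_real (koshliakov_weight p j * exp (- koshliakov_root p j))" for j
      by (simp flip: exp_of_real)
    have "summable (\<lambda>j. norm (of_real (koshliakov_weight p j) * exp (- (complex_of_real (koshliakov_root p j) * of_real 1))))"
      by (rule exp_dominated_series.summable_norm_term[OF koshliakov_sigma_series[OF p]]) simp
    then have "summable (\<lambda>j. complex_of_real (koshliakov_weight p j * exp (- koshliakov_root p j)))"
      unfolding of_real_1 eq by (rule summable_norm_cancel)
    then have "summable (\<lambda>j. koshliakov_weight p j * exp (- koshliakov_root p j))"
      by (simp only: summable_of_real_iff)
    then have "koshliakov_sigma p 1 = of_real (\<Sum>j. koshliakov_weight p j * exp (- koshliakov_root p j))"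
      unfolding koshliakov_sigma_def eq by (rule suminf_of_real[symmetric])
    then show ?thesis by simp
  qed
  have sin_int: "set_integrable lborel {0<..} (\<lambda>y. koshliakov_kernel p y * sin (y * t))" if "t > 0" for t
  proof (rule koshliakov_kernel_integrable[OF p, where C = t and n = 0])
    show "\<bar>sin (y * t)\<bar> \<le> t * y * y ^ 0" if "y > 0" for y
      using abs_sin_x_le_abs_x[of "y * t"] that \<open>t > 0\<close> by (simp add: abs_mult mult.commute)
  qed (intro continuous_intros)
  have sigma: "koshliakov_sigma p (of_real t) = of_real (1 / t + C + 2 * I t)" if t: "0 < t" "t < 1" for t
  proof -
    have "(LBINT y:{0<..}. koshliakov_kernel p y * (sin (y * t) - sin y)) =
       (LBINT y:{0<..}. koshliakov_kernel p y * sin (y * t) - koshliakov_kernel p y * sin (y * 1))"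
      by (simp add: right_diff_distrib)
    also have "\<dots> = I t - I 1"
      unfolding I_def using t by (intro set_integral_diff sin_int) auto
    finally have int_eq: "(LBINT y:{0<..}. koshliakov_kernel p y * (sin (y * t) - sin y)) = I t - I 1" .
    have "koshliakov_sigma p (of_real t) - koshliakov_sigma p 1 = of_real (1 / t - 1 + 2 * (I t - I 1))"
      using koshliakov_sigma_formula[OF p, of t] t unfolding int_eq by simp
    then have "koshliakov_sigma p (of_real t) = of_real (1 / t - 1 + 2 * (I t - I 1)) + of_real (Re (koshliakov_sigma p 1))"
      by (metis diff_add_cancel real1)
    then show ?thesis by (simp add: C_def algebra_simps)
  qed
  have b_sums: "(\<lambda>n. b n * t ^ n) sums (1 + C * t + 2 * t * I t)" if t: "0 < t" "t < 1" for t
  proof -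
    have "(\<lambda>k. 2 * t * (sin_coeff k * koshliakov_moment p k * t ^ k) + (if k = 0 then C * t else 0)) sums (2 * t * I t + C * t)"
      unfolding I_def by (intro sums_add sums_mult sine_transform_sums p t sums_single)
    moreover have "2 * t * (sin_coeff k * koshliakov_moment p k * t ^ k) + (if k = 0 then C * t else 0) = b (Suc k) * t ^ Suc k" for k
      by (simp add: b_def algebra_simps)
    ultimately have "(\<lambda>k. b (Suc k) * t ^ Suc k) sums (2 * t * I t + C * t)" by simp
    then have "(\<lambda>n. b n * t ^ n) sums (2 * t * I t + C * t + b 0 * t ^ 0)"
      by (rule sums_Suc)
    then show ?thesis by (simp add: b_def algebra_simps)
  qed
  have sums: "(\<lambda>n. complex_of_real (B n) / fact n * of_real t ^ n) sums (of_real t * koshliakov_sigma p (of_real t))"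
    if t: "0 < t" "t < 1" for t
  proof -
    have "(\<lambda>n. complex_of_real (b n * t ^ n)) sums of_real (1 + C * t + 2 * t * I t)"
      using b_sums[OF t] by (simp only: sums_of_real_iff)
    moreover have "complex_of_real (b n * t ^ n) = complex_of_real (B n) / fact n * of_real t ^ n" for n
      by (simp add: B_def)
    moreover have "of_real (1 + C * t + 2 * t * I t) = of_real t * koshliakov_sigma p (of_real t)"
    proof -
      have "1 + C * t + 2 * t * I t = t * (1 / t + C + 2 * I t)"
        using t by (simp add: field_simps)
      then show ?thesis unfolding sigma[OF t] by (simp only: of_real_mult)
    qed
    ultimately show ?thesis by simp
  qed
  have B: "gen_bernoulli2 p = B"
    by (rule gen_bernoulli2_eqI[OF sums])
  show "(\<lambda>n. complex_of_real (gen_bernoulli2 p n) / fact n * of_real t ^ n) sums (of_real t * koshliakov_sigma p (of_real t))"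
    if "0 < t" "t < 1" for t
    unfolding B by (rule sums[OF that])
  show "gen_bernoulli2 p (Suc n) = 2 * fact (Suc n) * sin_coeff n * koshliakov_moment p n" if "n \<ge> 1" for n
    using that unfolding B B_def b_def by simp
  show "summable (\<lambda>n. \<bar>gen_bernoulli2 p n / fact n\<bar> * t ^ n)" if t: "0 < t" "t < 1" for t
  proof -
    define u where "u = (1 + t) / 2"
    have u: "0 < u" "u < 1" "t < u" using t by (auto simp: u_def)
    have "summable (\<lambda>n. norm (b n * t ^ n))"
      using powser_insidea[of b u t] b_sums[OF u(1,2)] u t by (auto simp: sums_iff)
    then show ?thesis
      using t by (simp add: B B_def abs_mult)
  qed
qed

text \<open>
  On the imaginary axis \<open>z g(z) / f(z)\<close> equals \<open>y (1 + 2 h(y))\<close> at \<open>z = \<i>y\<close>, and that function is holomorphic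
  for \<open>\<bar>z\<bar> < 1/2\<close> because the nonzero zeros of \<open>f\<close> have absolute value above \<open>1/2\<close>.
\<close>
lemma koshliakov_kernel_power_series:
  assumes p: "p > 0"
  obtains a :: "nat \<Rightarrow> complex" where
    "\<And>y. 0 < y \<Longrightarrow> y < 1/4 \<Longrightarrow> (\<lambda>n. a n * of_real y ^ n) sums (of_real y * of_real (koshliakov_kernel p y))"
    "summable (\<lambda>n. norm (a n) * (1/4) ^ n)"
proof -
  define \<psi> where "\<psi> = (\<lambda>z. koshliakov_num p z / koshliakov_den_quotient p z)"
  have hol: "\<psi> holomorphic_on ball 0 (1/2)"
  proof -
    have "koshliakov_den_quotient p z \<noteq> 0" if "z \<in> ball 0 (1/2)" for z
    proof
      assume "koshliakov_den_quotient p z = 0"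
      moreover have "\<bar>Re z\<bar> < 1/2" using that abs_Re_le_cmod[of z] by simp
      ultimately obtain j where j: "z = of_real (koshliakov_root p j)"
        using koshliakov_den_quotient_eq_0D[OF p, of z] by (force simp: abs_less_iff)
      then show False
        using \<open>\<bar>Re z\<bar> < 1/2\<close> koshliakov_root_enumeration(3)[OF p, of j] by simp
    qed
    then show ?thesis
      unfolding \<psi>_def by (intro holomorphic_intros koshliakov_num_holomorphic koshliakov_den_quotient_holomorphic) auto
  qed
  define c where "c = (\<lambda>n. (deriv ^^ n) \<psi> 0 / fact n)"
  have c_sums: "(\<lambda>n. c n * w ^ n) sums \<psi> w" if "w \<in> ball 0 (1/2)" for w
    using holomorphic_power_series[OF hol that] by (simp add: c_def)
  define a where "a = (\<lambda>n. (c n * \<i> ^ n - (if n = 1 then 1 else 0)) / 2)"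
  show thesis
  proof (rule that[of a])
    fix y :: real assume y: "0 < y" "y < 1/4"
    have w: "\<i> * of_real y \<in> ball 0 (1/2)" "\<i> * of_real y \<noteq> 0"
      using y by (auto simp: norm_mult)
    have "\<psi> (\<i> * of_real y) = (\<i> * of_real y) * (koshliakov_num p (\<i> * of_real y) / koshliakov_den p (\<i> * of_real y))"
      using w(2) by (simp add: \<psi>_def koshliakov_den_quotient_def)
    also have "\<dots> = of_real y * of_real (1 + 2 * koshliakov_kernel p y)"
      unfolding koshliakov_quotient_imag_axis[OF p y(1)] by (simp add: complex_eq_iff)
    finally have \<psi>: "\<psi> (\<i> * of_real y) = of_real y * of_real (1 + 2 * koshliakov_kernel p y)" .
    have "(\<lambda>n. (c n * (\<i> * of_real y) ^ n - (if n = 1 then of_real y else 0)) / 2) sums ((\<psi> (\<i> * of_real y) - of_real y) / 2)"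
      by (intro sums_divide sums_diff c_sums w sums_single)
    moreover have "(c n * (\<i> * of_real y) ^ n - (if n = 1 then of_real y else 0)) / 2 = a n * of_real y ^ n" for n
      by (simp add: a_def power_mult_distrib algebra_simps diff_divide_distrib)
    moreover have "(\<psi> (\<i> * of_real y) - of_real y) / 2 = of_real y * of_real (koshliakov_kernel p y)"
      unfolding \<psi> by (simp add: algebra_simps)
    ultimately show "(\<lambda>n. a n * of_real y ^ n) sums (of_real y * of_real (koshliakov_kernel p y))"
      by simp
  next
    have "summable (\<lambda>n. c n * (1/3) ^ n)"
      by (rule sums_summable[OF c_sums]) simp
    then have c_summ: "summable (\<lambda>n. norm (c n * (1/4) ^ n))"
      by (rule powser_insidea) simp
    have "summable (\<lambda>n. norm (c n * (1/4) ^ n) + (if n = 1 then 1 else 0))"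
      by (intro summable_add c_summ sums_summable[OF sums_single])
    then show "summable (\<lambda>n. norm (a n) * (1/4) ^ n)"
    proof (rule summable_comparison_test')
      fix n :: nat
      have "norm (a n) \<le> (norm (c n * \<i> ^ n) + norm (if n = 1 then 1 else 0 :: complex)) / 2"
        unfolding a_def norm_divide by (simp add: divide_right_mono norm_triangle_ineq4 del: norm_mult)
      also have "\<dots> \<le> norm (c n) + (if n = 1 then 1 else 0)"
        by (simp add: norm_mult norm_power)
      finally have "norm (a n) * (1/4) ^ n \<le> (norm (c n) + (if n = 1 then 1 else 0)) * (1/4) ^ n"
        by (rule mult_right_mono) simp
      also have "\<dots> \<le> norm (c n * (1/4) ^ n) + (if n = 1 then 1 else 0)"
        by (simp add: norm_mult norm_power norm_divide)
      finally show "norm (norm (a n) * (1/4) ^ n) \<le> norm (c n * (1/4) ^ n) + (if n = 1 then 1 else 0)"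
        by simp
    qed
  qed
qed

section \<open>Special values\<close>

theorem koshliakov_zeta_minus_of_nat:
  assumes p: "p > 0"
  shows "koshliakov_zeta p (- of_nat m) = (-1) ^ m * of_real (gen_bernoulli2 p (Suc m)) / of_nat (Suc m)"
proof -
  interpret exp_dominated_series "\<lambda>j t. of_real (koshliakov_weight p j) * exp (- (of_real (koshliakov_root p j) * of_real t))"
    by (rule koshliakov_sigma_series[OF p])
  note B = gen_bernoulli2_sums[OF p]
  \<comment> \<open>Any \<open>c\<close> in \<open>(0, 1)\<close> is inside the interval of the expansion; the rate \<open>1/2\<close> is a lower bound for all roots.\<close>
  obtain E where E: "E holomorphic_on UNIV"
    "\<And>s. Re s > 1 \<Longrightarrow> rGamma s * (LBINT t:{0<..}. koshliakov_sigma p (of_real t) * of_real t powr (s - 1)) = E s / (s - 1)"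
    "\<And>m. E (- of_nat m) = (- of_nat m - 1) * ((-1) ^ m * fact m * (complex_of_real (gen_bernoulli2 p (Suc m)) / fact (Suc m)))"
  proof (rule Mellin_continuation[where h = "\<lambda>t. koshliakov_sigma p (of_real t)" and c = "1/2" and b = "1/2"
        and a = "\<lambda>n. complex_of_real (gen_bernoulli2 p n) / fact n" and C = "1 / (1 - exp (- (1/2)))"])
    show "continuous_on {0<..} (\<lambda>t. koshliakov_sigma p (of_real t))"
      using continuous_on_suminf unfolding koshliakov_sigma_def .
    show "norm (koshliakov_sigma p (of_real t)) \<le> 1 / (1 - exp (- (1/2))) * exp (- (1/2 * t))" if "1/2 \<le> t" for t
      using norm_suminf_le_exp[of "1/2" t] that unfolding koshliakov_sigma_def by simp
    show "summable (\<lambda>n. norm (complex_of_real (gen_bernoulli2 p n) / fact n) * (1/2) ^ n)"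
      using B(2)[of "1/2"] by (simp add: norm_divide)
  qed (use B(1) in auto)
  have ne: "- of_nat m - 1 \<noteq> (0::complex)"
    by (metis add_uminus_conv_diff minus_add_distrib neg_equal_0_iff_equal of_nat_Suc of_nat_eq_0_iff add.commute nat.distinct(2))
  have "koshliakov_zeta p (- of_nat m) = E (- of_nat m) / (- of_nat m - 1)"
    unfolding koshliakov_zeta_def
  proof (rule meromorphic_continuation_eqI[OF E(1)])
    show "koshliakov_zeta_series p s = E s / (s - 1)" if "Re s > 1" for s
      using koshliakov_zeta_series_Mellin[OF p that] E(2)[OF that] by simp
    show "- of_nat m \<noteq> (1::complex)" using ne by auto
  qed
  also have "\<dots> = (-1) ^ m * fact m * (of_real (gen_bernoulli2 p (Suc m)) / fact (Suc m))"
    unfolding E(3) using ne by simp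
  also have "\<dots> = (-1) ^ m * of_real (gen_bernoulli2 p (Suc m)) / of_nat (Suc m)"
    by (simp del: of_nat_Suc add: fact_Suc)
  finally show ?thesis .
qed

text \<open>
  At an integer \<open>n \<ge> 2\<close> the Mellin integral converges and is a moment. Its continuation has to be
  constructed all the same, since \<^const>\<open>koshliakov_eta\<close> is specified through it.
\<close>
theorem koshliakov_eta_of_nat:
  assumes p: "p > 0" and n: "n \<ge> 2"
  shows "koshliakov_eta p (of_nat n) = (2 * of_real pi) ^ n / fact (n - 1) * of_real (koshliakov_moment p (n - 1))"
proof -
  interpret exp_dominated_series "\<lambda>k t. of_real (koshliakov_ratio p t ^ Suc k)"
    by (rule koshliakov_kernel_series[OF p])
  obtain a where a: "\<And>y. 0 < y \<Longrightarrow> y < 1/4 \<Longrightarrow> (\<lambda>n. a n * of_real y ^ n) sums (complex_of_real y * of_real (koshliakov_kernel p y))"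
    "summable (\<lambda>n. norm (a n) * (1/4) ^ n)"
    by (rule koshliakov_kernel_power_series[OF p]) blast
  \<comment> \<open>The Taylor series at \<open>0\<close> converges for \<open>y < 1/2\<close>, hence absolutely at \<open>1/4\<close>.\<close>
  obtain E where E: "E holomorphic_on UNIV"
    "\<And>s. Re s > 1 \<Longrightarrow> rGamma s * (LBINT y:{0<..}. of_real (koshliakov_kernel p y) * of_real y powr (s - 1)) = E s / (s - 1)"
  proof (rule Mellin_continuation[where h = "\<lambda>y. complex_of_real (koshliakov_kernel p y)" and c = "1/4" and b = "1/2"
        and a = a and C = "1 / (1 - exp (- (1/4)))"])
    show "continuous_on {0<..} (\<lambda>y. complex_of_real (koshliakov_kernel p y))"
      by (intro continuous_intros continuous_on_koshliakov_kernel p)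
    show "norm (complex_of_real (koshliakov_kernel p y)) \<le> 1 / (1 - exp (- (1/4))) * exp (- (1/2 * y))" if "1/4 \<le> y" for y
      using norm_suminf_le_exp[of "1/4" y] that koshliakov_kernel_suminf[OF p, of y] by simp
  qed (use a in auto)
  define E' where "E' = (\<lambda>s. (2 * of_real pi) powr s * E s)"
  have series: "koshliakov_eta_series p s = E' s / (s - 1)" if "Re s > 1" for s
    using koshliakov_eta_series_Mellin[OF p that] E(2)[OF that] by (simp add: E'_def)
  have gt: "Re (of_nat n) > 1" using n by simp
  have "koshliakov_eta p (of_nat n) = E' (of_nat n) / (of_nat n - 1)"
    unfolding koshliakov_eta_def
  proof (rule meromorphic_continuation_eqI)
    show "E' holomorphic_on UNIV"
      unfolding E'_def by (intro holomorphic_intros E(1))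
    show "of_nat n \<noteq> (1::complex)" using gt by auto
  qed (rule series)
  also have "\<dots> = (2 * of_real pi) powr of_nat n *
      (rGamma (of_nat n) * (LBINT y:{0<..}. of_real (koshliakov_kernel p y) * of_real y powr (of_nat n - 1)))"
    using series[OF gt] koshliakov_eta_series_Mellin[OF p gt] by simp
  also have "(LBINT y:{0<..}. of_real (koshliakov_kernel p y) * complex_of_real y powr (of_nat n - 1)) =
      (LBINT y:{0<..}. complex_of_real (koshliakov_kernel p y * y ^ (n - 1)))"
  proof (intro set_lebesgue_integral_cong allI impI)
    fix y :: real assume "y \<in> {0<..}"
    then have y: "y > 0" by simp
    have "of_nat n - 1 = (of_nat (n - 1) :: complex)" using n by (simp add: of_nat_diff)
    then show "of_real (koshliakov_kernel p y) * complex_of_real y powr (of_nat n - 1) =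
        complex_of_real (koshliakov_kernel p y * y ^ (n - 1))"
      using y by (simp add: powr_nat)
  qed simp
  also have "\<dots> = of_real (koshliakov_moment p (n - 1))"
    unfolding koshliakov_moment_def set_lebesgue_integral_def
    by (simp flip: of_real_mult integral_complex_of_real add: scaleR_conv_of_real)
  also have "rGamma (of_nat n) = 1 / (fact (n - 1) :: complex)"
    using Gamma_fact[of "n - 1", where 'a = complex] n by (simp add: rGamma_inverse_Gamma divide_inverse of_nat_diff)
  also have "(2 * complex_of_real pi) powr of_nat n = (2 * of_real pi) ^ n"
    by (simp add: powr_nat)
  finally show ?thesis by simp
qed

theorem theorem2p1:
  fixes p :: real and m :: nat
  assumes "p > 0" and "m \<ge> 1"
  shows "koshliakov_zeta p (- of_nat m) =
           - (1 / of_nat (m + 1)) * of_real (gen_bernoulli2 p (m + 1))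
       \<and> koshliakov_eta p (of_nat (2 * m)) =
           (-1) ^ (m + 1) * (2 * of_real pi) ^ (2 * m) / (2 * fact (2 * m))
             * of_real (gen_bernoulli2 p (2 * m))"
proof
  note p = assms(1)
  note B = gen_bernoulli2_sums(3)[OF p]
  show "koshliakov_zeta p (- of_nat m) = - (1 / of_nat (m + 1)) * of_real (gen_bernoulli2 p (m + 1))"
  proof (cases "even m")
    case True
    then have "gen_bernoulli2 p (m + 1) = 0"
      using B[OF assms(2)] by (simp add: sin_coeff_def)
    then show ?thesis
      using koshliakov_zeta_minus_of_nat[OF p, of m] by simp
  next
    case False
    then show ?thesis
      using koshliakov_zeta_minus_of_nat[OF p, of m] by simp
  qed
  define M where "M = koshliakov_moment p (2 * m - 1)"
  have Suc: "2 * m = Suc (2 * m - 1)" using assms(2) by simp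
  have coeff: "sin_coeff (2 * m - 1) = (-1) ^ (m + 1) / fact (2 * m - 1)"
  proof -
    obtain k where k: "m = Suc k" using assms(2) by (cases m) auto
    then show ?thesis by (simp add: sin_coeff_def)
  qed
  have "gen_bernoulli2 p (2 * m) = 2 * fact (2 * m) * sin_coeff (2 * m - 1) * M"
    using B[of "2 * m - 1"] assms(2) unfolding Suc[symmetric] M_def by simp
  then have "(-1) ^ (m + 1) * gen_bernoulli2 p (2 * m) / (2 * fact (2 * m)) = M / fact (2 * m - 1)"
    unfolding coeff by (simp add: power_mult_distrib[symmetric] flip: power_add mult.assoc)
  then have "complex_of_real ((-1) ^ (m + 1) * gen_bernoulli2 p (2 * m) / (2 * fact (2 * m))) = of_real (M / fact (2 * m - 1))"
    by (simp only:)
  then have key: "(-1) ^ (m + 1) * complex_of_real (gen_bernoulli2 p (2 * m)) / (2 * fact (2 * m)) = of_real M / fact (2 * m - 1)"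
    by simp
  have "koshliakov_eta p (of_nat (2 * m)) = (2 * of_real pi) ^ (2 * m) * (of_real M / fact (2 * m - 1))"
    using koshliakov_eta_of_nat[OF p, of "2 * m"] assms(2) by (simp add: M_def)
  also have "\<dots> = (-1) ^ (m + 1) * (2 * of_real pi) ^ (2 * m) / (2 * fact (2 * m)) * of_real (gen_bernoulli2 p (2 * m))"
    unfolding key[symmetric] by (simp only: times_divide_eq_left times_divide_eq_right mult_ac)
  finally show "koshliakov_eta p (of_nat (2 * m)) =
       (-1) ^ (m + 1) * (2 * of_real pi) ^ (2 * m) / (2 * fact (2 * m)) * of_real (gen_bernoulli2 p (2 * m))" .
qed

end
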